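(* Let $d = d(n) \ge 1$ be an integer-valued function with $d(n) = o(\log n)$ as $n \to \infty$. Then for every sufficiently large $n$ there exist $m = m(n)$ and a set $X = X_n \subset \mathbb{R}^m$ with $|X| = n$, whose doubling dimension is $\Theta(\log n)$, and there is a sequence $K_n \to \infty$, such that, with $G : \mathbb{R}^m \to \mathbb{R}^{d}$ a random projection, $M$ the minimum spanning tree cost of $X$ and $\widetilde{\mathcal{M}}$ a minimum spanning tree of $GX$, with probability at least $2/3$ over $G$ the tree $\widetilde{\mathcal{M}}$, when pulled back to $X$, has cost at least $K_n \cdot M$ (i.e. $\omega(1) \cdot M$).
   Context: All norms are Euclidean. The minimum spanning tree cost of a finite point set $Y$ in a Euclidean space is the minimum over spanning trees $T$ on $Y$ of $\sum_{(x,y)\in T}\|x-y\|$, and a minimum spanning tree is a minimizer. $GX = \{Gx : x\in X\}$. A spanning tree of $GX$ is pulled back to a spanning tree of $X$ via the correspondence $Gx \leftrightarrow x$ (almost surely a bijection), i.e. each edge $(Gx,Gy)$ becomes $(x,y)$, and the cost of the pulled back tree is $\sum \|x-y\|$ over its edges, measured in $\mathbb{R}^m$. Doubling dimension: for $x \in X$, $r > 0$ let $B(x,r) = \{y \in X : \|x-y\| \le r\}$. The doubling constant $\lambda_X$ is the smallest $\lambda$ such that for all $x \in X$, $r > 0$ there is $S \subseteq X$ with $|S| \le \lambda$ and $B(x,r) \subseteq \bigcup_{s \in S} B(s, r/2)$. The doubling dimension is $d_X = \log_2 \lambda_X$. A random projection from $\mathbb{R}^m$ to $\mathbb{R}^d$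 is a random linear map $G$ given by a $d \times m$ matrix with i.i.d. entries drawn from $\mathcal{N}(0, 1/d)$ (variance $1/d$). *)

theory Defs
  imports "HOL-Probability.Probability" "HOL-Library.Landau_Symbols"
begin

text \<open>
  Since the dimension of the ambient space is existentially quantified, \<open>\<real>\<^sup>k\<close> is represented by
  \<open>topspace (Euclidean_space k)\<close>, the functions \<open>nat \<Rightarrow> real\<close> vanishing at all indices \<open>\<ge> k\<close>.
\<close>

definition edist :: "nat \<Rightarrow> (nat \<Rightarrow> real) \<Rightarrow> (nat \<Rightarrow> real) \<Rightarrow> real" where
  "edist k x y = L2_set (\<lambda>i. x i - y i) {..<k}"


subsection \<open>Doubling dimension\<close>

definition rel_ball :: "nat \<Rightarrow> (nat \<Rightarrow> real) set \<Rightarrow> (nat \<Rightarrow> real) \<Rightarrow> real \<Rightarrow> (nat \<Rightarrow> real) set" where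
  "rel_ball k X x r = {y \<in> X. edist k x y \<le> r}"

definition doubling_const :: "nat \<Rightarrow> (nat \<Rightarrow> real) set \<Rightarrow> nat" where
  "doubling_const k X = (LEAST l. \<forall>x\<in>X. \<forall>r>0. \<exists>S\<subseteq>X. finite S \<and> card S \<le> l \<and>
     rel_ball k X x r \<subseteq> (\<Union>s\<in>S. rel_ball k X s (r / 2)))"

definition doubling_dim :: "nat \<Rightarrow> (nat \<Rightarrow> real) set \<Rightarrow> real" where
  "doubling_dim k X = log 2 (real (doubling_const k X))"


subsection \<open>Minimum spanning trees\<close>

text \<open>Undirected graphs are given by their edge sets, an edge being a two-element set of points.\<close>

definition arcs_of :: "'a set set \<Rightarrow> ('a \<times> 'a) set" where
  "arcs_of T = {(u, v). {u, v} \<in> T}"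

definition is_cycle :: "'a set set \<Rightarrow> 'a list \<Rightarrow> bool" where
  "is_cycle T vs \<longleftrightarrow> length vs \<ge> 3 \<and> distinct vs \<and>
     (\<forall>i<length vs. {vs ! i, vs ! (Suc i mod length vs)} \<in> T)"

definition spanning_tree :: "'a set \<Rightarrow> 'a set set \<Rightarrow> bool" where
  "spanning_tree Y T \<longleftrightarrow>
     T \<subseteq> {{u, v} | u v. u \<in> Y \<and> v \<in> Y \<and> u \<noteq> v} \<and>
     (\<forall>u\<in>Y. \<forall>v\<in>Y. (u, v) \<in> (arcs_of T)\<^sup>*) \<and>
     \<not> (\<exists>vs. is_cycle T vs)"

text \<open>The factor \<open>1/2\<close> is there because \<open>arcs_of\<close> contains both orientations of every edge.\<close>

definition tree_cost :: "nat \<Rightarrow> (nat \<Rightarrow> real) set set \<Rightarrow> real" where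
  "tree_cost k T = (\<Sum>(u, v)\<in>arcs_of T. edist k u v) / 2"

definition is_mst :: "nat \<Rightarrow> (nat \<Rightarrow> real) set \<Rightarrow> (nat \<Rightarrow> real) set set \<Rightarrow> bool" where
  "is_mst k Y T \<longleftrightarrow> is_arg_min (tree_cost k) (spanning_tree Y) T"

definition mst_cost :: "nat \<Rightarrow> (nat \<Rightarrow> real) set \<Rightarrow> real" where
  "mst_cost k Y = Min (tree_cost k ` {T. spanning_tree Y T})"

text \<open>Meaningful only if \<open>f\<close> is injective on \<open>X\<close>.\<close>

definition pull_back :: "('a \<Rightarrow> 'b) \<Rightarrow> 'a set \<Rightarrow> 'b set set \<Rightarrow> 'a set set" where
  "pull_back f X T = (\<lambda>e. inv_into X f ` e) ` T"


subsection \<open>Random projections\<close>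

text \<open>The second parameter of \<open>normal_density\<close> is the standard deviation.\<close>

definition gaussian_matrix :: "nat \<Rightarrow> nat \<Rightarrow> (nat \<times> nat \<Rightarrow> real) measure" where
  "gaussian_matrix d m =
     (\<Pi>\<^sub>M ij\<in>{..<d} \<times> {..<m}. density lborel (normal_density 0 (sqrt (1 / real d))))"

definition lin_map :: "nat \<Rightarrow> nat \<Rightarrow> (nat \<times> nat \<Rightarrow> real) \<Rightarrow> (nat \<Rightarrow> real) \<Rightarrow> nat \<Rightarrow> real" where
  "lin_map d m A x = (\<lambda>i. if i < d then \<Sum>j<m. A (i, j) * x j else 0)"

end

theory Submission
  imports Defs
begin

text \<open>
  Put \<open>k = s\<^sup>2\<close> and \<open>\<delta> = 1/s\<close>, where \<open>s\<close> tends to infinity slowly with \<open>n\<close>, and group the points into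
  clusters of \<open>k\<close> points: the cluster \<open>i\<close> consists of the points \<open>e\<^sub>i + \<delta> j e\<^sub>0\<close> with \<open>j < k\<close>
  (and \<open>e\<^sub>i\<close> is replaced by the origin for \<open>i = 0\<close>). Following the clusters gives a spanning tree of
  cost \<open>O(n \<delta>)\<close>.

  A bounded region of \<open>\<real>\<^sup>d\<close> is covered by \<open>C\<^sup>d\<close> cells of diameter \<open>\<eta>\<close>, a small multiple of \<open>\<delta>\<close>, and
  \<open>C\<^sup>d\<close> is negligible against the number of clusters because \<open>d = o(log n)\<close>. Hence, by pigeonhole,
  almost every projected cluster is a translate by at most \<open>\<eta>\<close> of an earlier one. Joining such
  clusters pointwise yields a spanning tree of the projected points whose cost is a small multiple of
  \<open>n \<delta> |G e\<^sub>0|\<close>. Each edge inside a cluster has projected length at least \<open>\<delta> |G e\<^sub>0|\<close>, so a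
  minimum spanning tree has few of them, and every other edge pulls back to an edge of length at
  least \<open>1\<close>. The pulled back cost is therefore of order \<open>n\<close>. The only probabilistic input is Markov's
  inequality for \<open>|G e\<^sub>0|\<^sup>2\<close>, for its exponential moment, and for \<open>\<Sum>\<^sub>i |G e\<^sub>i|\<^sup>2\<close>.
\<close>

section \<open>Spanning trees\<close>

lemma arcs_of_iff: "(u, v) \<in> arcs_of T \<longleftrightarrow> {u, v} \<in> T"
  by (simp add: arcs_of_def)

lemma arcs_of_sym: "(u, v) \<in> arcs_of T \<Longrightarrow> (v, u) \<in> arcs_of T"
  by (simp add: arcs_of_def insert_commute)

lemma spanning_tree_edge:
  assumes "spanning_tree Y T" "e \<in> T"
  obtains u v where "e = {u, v}" "u \<in> Y" "v \<in> Y" "u \<noteq> v"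
  using assms unfolding spanning_tree_def by blast

lemma spanning_tree_edge_subset: "spanning_tree Y T \<Longrightarrow> e \<in> T \<Longrightarrow> e \<subseteq> Y"
  by (auto elim!: spanning_tree_edge)

lemma spanning_tree_arc:
  assumes "spanning_tree Y T" "(u, v) \<in> arcs_of T"
  shows "u \<in> Y" "v \<in> Y" "u \<noteq> v"
proof -
  have "{u, v} \<in> T" using assms(2) by (simp add: arcs_of_def)
  from spanning_tree_edge[OF assms(1) this] obtain x y
    where "{u, v} = {x, y}" "x \<in> Y" "y \<in> Y" "x \<noteq> y" .
  then show "u \<in> Y" "v \<in> Y" "u \<noteq> v" by (auto simp: doubleton_eq_iff)
qed

lemma finite_arcs_of:
  assumes "spanning_tree Y T" "finite Y"
  shows "finite (arcs_of T)"
  by (rule finite_subset[of _ "Y \<times> Y"]) (use assms spanning_tree_arc[OF assms(1)] in auto)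

lemma finite_spanning_trees:
  assumes "finite Y"
  shows "finite {T. spanning_tree Y T}"
proof (rule finite_subset)
  show "{T. spanning_tree Y T} \<subseteq> Pow (Pow Y)"
    using spanning_tree_edge_subset by auto
qed (use assms in simp)

text \<open>The weight is arbitrary and the vertices need not be points, so one tree on indices can
  be priced both by the original distances and by the projected ones.\<close>

definition wcost :: "('a \<Rightarrow> 'a \<Rightarrow> real) \<Rightarrow> 'a set set \<Rightarrow> real" where
  "wcost w T = (\<Sum>(u, v)\<in>arcs_of T. w u v) / 2"

lemma tree_cost_eq_wcost: "tree_cost k = wcost (edist k)"
  by (simp add: tree_cost_def wcost_def fun_eq_iff)

section \<open>Rooted trees given by a parent map\<close>

definition parent_tree :: "'a set \<Rightarrow> 'a \<Rightarrow> ('a \<Rightarrow> 'a) \<Rightarrow> 'a set set" where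
  "parent_tree Y r p = (\<lambda>y. {y, p y}) ` (Y - {r})"

text \<open>\<open>rank\<close> certifies that following parents ends at the root. It is
  instantiated by the distance to the root in a connected graph and by the identity on
  indices.\<close>

locale parent_graph =
  fixes Y :: "'a set" and r :: 'a and p :: "'a \<Rightarrow> 'a" and rank :: "'a \<Rightarrow> nat"
  assumes root: "r \<in> Y"
    and parent_in: "\<And>y. y \<in> Y \<Longrightarrow> y \<noteq> r \<Longrightarrow> p y \<in> Y"
    and parent_less: "\<And>y. y \<in> Y \<Longrightarrow> y \<noteq> r \<Longrightarrow> rank (p y) < rank y"
begin

lemma edge_cases:
  assumes "{u, v} \<in> parent_tree Y r p"
  shows "u \<in> Y - {r} \<and> v = p u \<or> v \<in> Y - {r} \<and> u = p v"
  using assms by (auto simp: parent_tree_def doubleton_eq_iff)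

lemma reaches_root:
  assumes "y \<in> Y"
  shows "(y, r) \<in> (arcs_of (parent_tree Y r p))\<^sup>*"
  using assms
proof (induction "rank y" arbitrary: y rule: less_induct)
  case less
  show ?case
  proof (cases "y = r")
    case False
    have "(y, p y) \<in> arcs_of (parent_tree Y r p)"
      using less.prems False by (auto simp: arcs_of_def parent_tree_def)
    then show ?thesis
      using less.hyps[OF parent_less parent_in] less.prems False by (meson converse_rtrancl_into_rtrancl)
  qed simp
qed

text \<open>A vertex of maximal rank on a cycle would have two distinct parents.\<close>

lemma no_cycle: "\<not> is_cycle (parent_tree Y r p) vs"
proof
  assume c: "is_cycle (parent_tree Y r p) vs"
  define l where "l = length vs"
  have l3: "l \<ge> 3" and dist: "distinct vs"
    and edge: "\<And>i. i < l \<Longrightarrow> {vs ! i, vs ! (Suc i mod l)} \<in> parent_tree Y r p"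
    using c by (auto simp: is_cycle_def l_def)
  have "finite ((\<lambda>i. rank (vs ! i)) ` {..<l})" "(\<lambda>i. rank (vs ! i)) ` {..<l} \<noteq> {}"
    using l3 by (auto simp: lessThan_empty_iff)
  from Max_in[OF this] obtain i where i: "i < l"
    and imax: "rank (vs ! i) = Max ((\<lambda>i. rank (vs ! i)) ` {..<l})"
    by auto
  have max: "rank (vs ! j) \<le> rank (vs ! i)" if "j < l" for j
    unfolding imax using that by (intro Max_ge) auto
  define a where "a = Suc i mod l"
  define b where "b = (if i = 0 then l - 1 else i - 1)"
  have a: "a < l" and b: "b < l" and bi: "Suc b mod l = i" and ab: "a \<noteq> b"
    using l3 i by (auto simp: a_def b_def mod_Suc)
  have par: "vs ! j = p (vs ! i)" if "j < l" "{vs ! i, vs ! j} \<in> parent_tree Y r p" for j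
    using edge_cases[OF that(2)] parent_less[of "vs ! j"] max[OF that(1)] by auto
  have "vs ! a = p (vs ! i)"
    using par[OF a] edge[OF i] by (simp add: a_def)
  moreover have "vs ! b = p (vs ! i)"
    using par[OF b] edge[OF b] by (simp add: bi insert_commute)
  ultimately show False
    using nth_eq_iff_index_eq[OF dist, of a b] a b ab by (simp add: l_def)
qed

lemma spanning_tree_parent: "spanning_tree Y (parent_tree Y r p)"
  unfolding spanning_tree_def
proof (intro conjI ballI)
  show "parent_tree Y r p \<subseteq> {{u, v} | u v. u \<in> Y \<and> v \<in> Y \<and> u \<noteq> v}"
  proof
    fix e assume "e \<in> parent_tree Y r p"
    then obtain y where y: "y \<in> Y" "y \<noteq> r" "e = {y, p y}" by (auto simp: parent_tree_def)
    then have "p y \<in> Y" by (intro parent_in)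
    moreover have "y \<noteq> p y" using parent_less[OF y(1,2)] by (metis less_irrefl)
    ultimately
    show "e \<in> {{u, v} | u v. u \<in> Y \<and> v \<in> Y \<and> u \<noteq> v}" using y(1,3) by blast
  qed
next
  fix u v assume u: "u \<in> Y" and v: "v \<in> Y"
  have "sym ((arcs_of (parent_tree Y r p))\<^sup>*)"
    by (rule sym_rtrancl, rule symI, rule arcs_of_sym)
  then have "(r, v) \<in> (arcs_of (parent_tree Y r p))\<^sup>*"
    using reaches_root[OF v] by (rule symD)
  then show "(u, v) \<in> (arcs_of (parent_tree Y r p))\<^sup>*"
    using reaches_root[OF u] by (rule rtrancl_trans[rotated])
qed (simp add: no_cycle)

lemma arcs_parent:
  "arcs_of (parent_tree Y r p) = (\<lambda>y. (y, p y)) ` (Y - {r}) \<union> (\<lambda>y. (p y, y)) ` (Y - {r})"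
proof (intro equalityI subsetI)
  fix a assume "a \<in> arcs_of (parent_tree Y r p)"
  then obtain u v where a: "a = (u, v)" "{u, v} \<in> parent_tree Y r p" by (auto simp: arcs_of_def)
  from edge_cases[OF a(2)]
  show "a \<in> (\<lambda>y. (y, p y)) ` (Y - {r}) \<union> (\<lambda>y. (p y, y)) ` (Y - {r})"
  proof (elim disjE conjE)
    assume "u \<in> Y - {r}" "v = p u"
    then show ?thesis unfolding a(1) by (intro UnI1 image_eqI[of _ _ u]) simp_all
  next
    assume "v \<in> Y - {r}" "u = p v"
    then show ?thesis unfolding a(1) by (intro UnI2 image_eqI[of _ _ v]) simp_all
  qed
next
  have "(y, p y) \<in> arcs_of (parent_tree Y r p)" if "y \<in> Y - {r}" for y
    using that by (auto simp: arcs_of_def parent_tree_def)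
  then show "a \<in> arcs_of (parent_tree Y r p)"
    if "a \<in> (\<lambda>y. (y, p y)) ` (Y - {r}) \<union> (\<lambda>y. (p y, y)) ` (Y - {r})" for a
    using that by (elim UnE imageE) (auto intro: arcs_of_sym)
qed

text \<open>An arc of both kinds would make two vertices parents of each other, and the rank would
  have to decrease both ways.\<close>

lemma arcs_parent_disjoint:
  "(\<lambda>y. (y, p y)) ` (Y - {r}) \<inter> (\<lambda>y. (p y, y)) ` (Y - {r}) = {}"
proof (rule equals0I)
  fix a assume a: "a \<in> (\<lambda>y. (y, p y)) ` (Y - {r}) \<inter> (\<lambda>y. (p y, y)) ` (Y - {r})"
  obtain y where y: "y \<in> Y - {r}" "a = (y, p y)" using a by (elim IntE imageE)
  obtain z where z: "z \<in> Y - {r}" "a = (p z, z)" using a by (elim IntE imageE)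
  have "rank (p y) < rank y" "rank (p z) < rank z" using y(1) z(1) parent_less by auto
  moreover have "rank y = rank (p z)" "rank (p y) = rank z" 
    using y(2) z(2) by (metis prod.inject)+
  ultimately show False by linarith
qed

text \<open>The two orientations are disjoint copies of the edge set, so by symmetry the arc sum is
  twice the parent sum, which the factor 1/2 in \<open>wcost\<close> undoes.\<close>

lemma wcost_parent:
  assumes "finite Y" and sym: "\<And>u v. w u v = w v u"
  shows "wcost w (parent_tree Y r p) = (\<Sum>y\<in>Y - {r}. w y (p y))"
  unfolding wcost_def arcs_parent
  by (subst sum.union_disjoint)
     (use assms(1) arcs_parent_disjoint sym in
       \<open>auto simp: sum.reindex inj_on_def o_def\<close>)

lemma card_arcs_parent:
  assumes "finite Y"
  shows "card (arcs_of (parent_tree Y r p)) = 2 * (card Y - 1)"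
  unfolding arcs_parent
  by (subst card_Un_disjoint)
     (use assms arcs_parent_disjoint root in \<open>auto simp: card_image inj_on_def\<close>)

end

text \<open>A connected graph contains the parent graph of a breadth-first search.\<close>

lemma card_arcs_spanning_tree:
  assumes T: "spanning_tree Y T" and fin: "finite Y"
  shows "2 * (card Y - 1) \<le> card (arcs_of T)"
proof (cases "Y = {}")
  case False
  then obtain r where r: "r \<in> Y" by auto
  define rank where "rank v = (LEAST n. (r, v) \<in> arcs_of T ^^ n)" for v
  have reach: "(r, v) \<in> arcs_of T ^^ rank v" if "v \<in> Y" for v
  proof -
    have "\<exists>n. (r, v) \<in> arcs_of T ^^ n"
      using T r that unfolding spanning_tree_def by (meson rtrancl_imp_relpow)
    then show ?thesis unfolding rank_def by (rule LeastI_ex)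
  qed
  \<comment> \<open>The last vertex before \<open>v\<close> on a shortest walk from \<open>r\<close>
    is closer to \<open>r\<close> and serves as parent.\<close>
  have "\<exists>u. (u, v) \<in> arcs_of T \<and> rank u < rank v" if v: "v \<in> Y" "v \<noteq> r" for v
  proof -
    have "rank v \<noteq> 0" using reach[OF v(1)] v(2) by (metis pair_in_Id_conv relpow.simps(1))
    then obtain n where n: "rank v = Suc n" by (cases "rank v") auto
    then obtain u where u: "(r, u) \<in> arcs_of T ^^ n" "(u, v) \<in> arcs_of T"
      using reach[OF v(1)] by auto
    have "rank u \<le> n" unfolding rank_def using u(1) by (rule Least_le)
    then show ?thesis using u n by auto
  qed
  then obtain p where p: "\<And>v. v \<in> Y \<Longrightarrow> v \<noteq> r \<Longrightarrow> (p v, v) \<in> arcs_of T \<and> rank (p v) < rank v"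
    by metis
  interpret parent_graph Y r p rank
    by unfold_locales (use r p spanning_tree_arc[OF T] in auto)
  have "arcs_of (parent_tree Y r p) \<subseteq> arcs_of T"
    unfolding arcs_parent using p by (auto intro: arcs_of_sym)
  then show ?thesis
    using card_mono[OF finite_arcs_of[OF T fin]] card_arcs_parent[OF fin] by metis
qed simp

section \<open>Transport of spanning trees along an injection\<close>

lemma arcs_of_image:
  assumes T: "spanning_tree Y T" and inj: "inj_on f Y"
  shows "arcs_of ((`) f ` T) = map_prod f f ` arcs_of T"
proof (intro equalityI subsetI)
  fix a assume "a \<in> arcs_of ((`) f ` T)"
  then obtain u v e where a: "a = (u, v)" and e: "e \<in> T" "{u, v} = f ` e"
    by (auto simp: arcs_of_def)
  obtain x y where xy: "e = {x, y}" using spanning_tree_edge[OF T e(1)] by metis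
  then have "(x, y) \<in> arcs_of T" "(y, x) \<in> arcs_of T"
    using e(1) by (auto simp: arcs_of_def insert_commute)
  moreover have "a = map_prod f f (x, y) \<or> a = map_prod f f (y, x)"
    using e(2) xy a by (auto simp: doubleton_eq_iff)
  ultimately show "a \<in> map_prod f f ` arcs_of T" by blast
next
  fix a assume "a \<in> map_prod f f ` arcs_of T"
  then obtain x y where xy: "{x, y} \<in> T" "a = (f x, f y)"
    by (auto simp: arcs_of_def)
  have "f ` {x, y} \<in> (`) f ` T" using xy(1) by (rule imageI)
  then show "a \<in> arcs_of ((`) f ` T)" using xy(2) by (simp add: arcs_of_def)
qed

text \<open>Arcs are carried over bijectively, so a tree of points can be replaced by a tree of
  indices with the pulled back weight.\<close>

lemma wcost_image:
  assumes T: "spanning_tree Y T" and inj: "inj_on f Y"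
  shows "wcost w ((`) f ` T) = wcost (\<lambda>u v. w (f u) (f v)) T"
proof -
  have "inj_on (map_prod f f) (arcs_of T)"
    using inj spanning_tree_arc[OF T] by (auto simp: inj_on_def)
  then show ?thesis
    unfolding wcost_def arcs_of_image[OF T inj]
    by (simp add: sum.reindex o_def case_prod_unfold)
qed

lemma spanning_tree_image:
  assumes T: "spanning_tree Y T" and inj: "inj_on f Y"
  shows "spanning_tree (f ` Y) ((`) f ` T)"
  unfolding spanning_tree_def
proof (intro conjI)
  show "(`) f ` T \<subseteq> {{u, v} |u v. u \<in> f ` Y \<and> v \<in> f ` Y \<and> u \<noteq> v}"
  proof
    fix e assume "e \<in> (`) f ` T"
    then obtain e' where e': "e' \<in> T" "e = f ` e'" by auto
    obtain u v where "e' = {u, v}" "u \<in> Y" "v \<in> Y" "u \<noteq> v" using spanning_tree_edge[OF T e'(1)] .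
    then have "e = {f u, f v}" "f u \<in> f ` Y" "f v \<in> f ` Y" "f u \<noteq> f v"
      using e' inj by (auto dest: inj_onD)
    then show "e \<in> {{u, v} |u v. u \<in> f ` Y \<and> v \<in> f ` Y \<and> u \<noteq> v}" by blast
  qed
next
  have "(f u, f v) \<in> (arcs_of ((`) f ` T))\<^sup>*" if "(u, v) \<in> (arcs_of T)\<^sup>*" for u v
    using that
  proof induction
    case (step y z)
    then have "(f y, f z) \<in> arcs_of ((`) f ` T)"
      by (auto simp: arcs_of_image[OF T inj])
    with step.IH show ?case by (rule rtrancl_into_rtrancl)
  qed simp
  then show "\<forall>u\<in>f ` Y. \<forall>v\<in>f ` Y. (u, v) \<in> (arcs_of ((`) f ` T))\<^sup>*"
    using T by (auto simp: spanning_tree_def)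
next
  show "\<nexists>vs. is_cycle ((`) f ` T) vs"
  proof
    assume "\<exists>vs. is_cycle ((`) f ` T) vs"
    then obtain vs where l: "length vs \<ge> 3" and dist: "distinct vs"
      and edge: "\<And>i. i < length vs \<Longrightarrow> (vs ! i, vs ! (Suc i mod length vs)) \<in> arcs_of ((`) f ` T)"
      unfolding is_cycle_def arcs_of_iff by blast
    \<comment> \<open>A cycle in the image is carried back by the inverse of \<open>f\<close>, which
      is injective on its vertices.\<close>
    define g where "g = inv_into Y f"
    have g: "g (f u) = u" if "u \<in> Y" for u using inj that by (simp add: g_def)
    have pre: "(g (vs ! i), g (vs ! (Suc i mod length vs))) \<in> arcs_of T \<and> vs ! i \<in> f ` Y"
      if "i < length vs" for i
      using edge[OF that] spanning_tree_arc[OF T] by (auto simp: arcs_of_image[OF T inj] g)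
    have mod_less: "i mod length vs < length vs" for i using l by (intro mod_less_divisor) linarith
    have "set vs \<subseteq> f ` Y" using pre by (auto simp: in_set_conv_nth)
    then have "inj_on g (set vs)" unfolding g_def by (rule inj_on_inv_into)
    then have "is_cycle T (map g vs)"
      unfolding is_cycle_def using l dist pre mod_less
      by (simp add: distinct_map arcs_of_iff)
    then show False using T by (auto simp: spanning_tree_def)
  qed
qed

text \<open>The inverse of \<open>f\<close> carries trees back, so minimising over trees on the
  image is the same as minimising over trees on \<open>Y\<close>.\<close>

lemma spanning_trees_image:
  assumes inj: "inj_on f Y"
  shows "{T. spanning_tree (f ` Y) T} = (`) ((`) f) ` {T. spanning_tree Y T}"
proof (intro equalityI subsetI)
  fix T assume "T \<in> {T. spanning_tree (f ` Y) T}"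
  then have T: "spanning_tree (f ` Y) T" by simp
  define g where "g = inv_into Y f"
  have "inj_on g (f ` Y)" unfolding g_def by (rule inj_on_inv_into) simp
  from spanning_tree_image[OF T this] have "spanning_tree Y ((`) g ` T)"
    using inj by (simp add: g_def)
  moreover have "T = (`) f ` ((`) g ` T)"
  proof -
    have "f ` g ` e = e" if "e \<in> T" for e
    proof -
      have "e \<subseteq> f ` Y" using spanning_tree_edge_subset[OF T that] .
      then show ?thesis by (simp add: g_def image_inv_into_cancel)
    qed
    then have "(\<lambda>e. f ` g ` e) ` T = (\<lambda>e. e) ` T" by (rule image_cong[OF refl])
    then show ?thesis unfolding image_image[of "(`) f" "(`) g"] by simp
  qed
  ultimately show "T \<in> (`) ((`) f) ` {T. spanning_tree Y T}" by blast
next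
  fix T assume "T \<in> (`) ((`) f) ` {T. spanning_tree Y T}"
  then obtain T' where T': "T = (`) f ` T'" "spanning_tree Y T'" by blast
  show "T \<in> {T. spanning_tree (f ` Y) T}"
    unfolding T'(1) mem_Collect_eq by (rule spanning_tree_image[OF T'(2) inj])
qed

lemma pull_back_image:
  assumes T: "spanning_tree Y T" and inj: "inj_on f Y"
  shows "pull_back f Y ((`) f ` T) = T"
proof -
  have "inv_into Y f ` f ` e = e" if "e \<in> T" for e
    using inj spanning_tree_edge_subset[OF T that] by simp
  then have "(\<lambda>e. inv_into Y f ` f ` e) ` T = (\<lambda>e. e) ` T" by (rule image_cong[OF refl])
  then show ?thesis unfolding pull_back_def image_image[of _ "(`) f"] by simp
qed

text \<open>Minimality is expressed over the trees on \<open>Y\<close>, a family that does not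
  depend on \<open>f\<close>. For a random \<open>f\<close> only the weights remain random, which
  makes measurability accessible.\<close>

lemma is_mst_image:
  assumes inj: "inj_on f Y"
  shows "is_mst k (f ` Y) T \<longleftrightarrow> (\<exists>S. spanning_tree Y S \<and> T = (`) f ` S \<and>
    (\<forall>S'. spanning_tree Y S' \<longrightarrow>
      wcost (\<lambda>u v. edist k (f u) (f v)) S \<le> wcost (\<lambda>u v. edist k (f u) (f v)) S'))"
proof -
  let ?c = "wcost (\<lambda>u v. edist k (f u) (f v))"
  have cost: "tree_cost k ((`) f ` S) = ?c S" if "spanning_tree Y S" for S
    unfolding tree_cost_eq_wcost using that inj by (rule wcost_image)
  have mst: "is_mst k (f ` Y) T \<longleftrightarrow> spanning_tree (f ` Y) T \<and>
      (\<forall>T'. spanning_tree (f ` Y) T' \<longrightarrow> tree_cost k T \<le> tree_cost k T')"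
    unfolding is_mst_def is_arg_min_linorder ..
  show ?thesis
  proof
    assume L: "is_mst k (f ` Y) T"
    then have "T \<in> (`) ((`) f) ` {S. spanning_tree Y S}"
      unfolding spanning_trees_image[OF inj, symmetric] mst by simp
    then obtain S where S: "spanning_tree Y S" "T = (`) f ` S" by blast
    have "?c S \<le> ?c S'" if "spanning_tree Y S'" for S'
    proof -
      have "tree_cost k T \<le> tree_cost k ((`) f ` S')"
        using L spanning_tree_image[OF that inj] unfolding mst by blast
      then show ?thesis unfolding S(2) cost[OF S(1)] cost[OF that] .
    qed
    then show "\<exists>S. spanning_tree Y S \<and> T = (`) f ` S \<and> (\<forall>S'. spanning_tree Y S' \<longrightarrow> ?c S \<le> ?c S')"
      using S by blast
  next
    assume "\<exists>S. spanning_tree Y S \<and> T = (`) f ` S \<and> (\<forall>S'. spanning_tree Y S' \<longrightarrow> ?c S \<le> ?c S')"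
    then obtain S where S: "spanning_tree Y S" "T = (`) f ` S"
      and min: "\<And>S'. spanning_tree Y S' \<Longrightarrow> ?c S \<le> ?c S'" by blast
    have "tree_cost k T \<le> tree_cost k T'" if "spanning_tree (f ` Y) T'" for T'
    proof -
      from that have "T' \<in> (`) ((`) f) ` {S. spanning_tree Y S}"
        unfolding spanning_trees_image[OF inj, symmetric] by simp
      then obtain S' where S': "spanning_tree Y S'" "T' = (`) f ` S'" by blast
      show ?thesis unfolding S(2) S'(2) cost[OF S(1)] cost[OF S'(1)] by (rule min[OF S'(1)])
    qed
    then show "is_mst k (f ` Y) T"
      unfolding mst using spanning_tree_image[OF S(1) inj] S(2) by simp
  qed
qed

section \<open>Grid cells and cluster trees\<close>

text \<open>The value is \<open>1 + 2 * (1 - (1 / 2) ^ L)\<close>: the term at 0 and two geometric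
  sums. It stays below 3 for every \<open>L\<close>, which bounds the factor of one coordinate in
  the lattice point count.\<close>

lemma sum_half_power_abs:
  "(\<Sum>v\<in>{- int L..int L}. (1 / 2) ^ nat \<bar>v\<bar>) = 3 - 2 * (1 / 2 :: real) ^ L"
proof (induction L)
  case (Suc L)
  have "{- int (Suc L)..int (Suc L)} = insert (- int (Suc L)) (insert (int (Suc L)) {- int L..int L})"
    by auto
  then show ?case using Suc by (simp add: nat_add_distrib)
qed simp

text \<open>Each of the lattice points is counted with the weight \<open>2 ^ (B d - \<Sum>\<bar>z l\<bar>) \<ge> 1\<close>.\<close>

lemma card_lattice_points:
  fixes B d :: nat
  defines "Z \<equiv> {z \<in> {..<d} \<rightarrow>\<^sub>E (UNIV :: int set). (\<Sum>l<d. \<bar>z l\<bar>) \<le> int (B * d)}"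
  shows "finite Z" "card Z \<le> (3 * 2 ^ B) ^ d"
proof -
  define L where "L = B * d"
  define P where "P = {..<d} \<rightarrow>\<^sub>E {- int L..int L}"
  have finP: "finite P" unfolding P_def by (intro finite_PiE) auto
  have ZP: "Z \<subseteq> P"
  proof
    fix z assume z: "z \<in> Z"
    have "\<bar>z l\<bar> \<le> int L" if "l < d" for l
      using member_le_sum[of l "{..<d}" "\<lambda>l. \<bar>z l\<bar>"] z that by (auto simp: Z_def L_def)
    then show "z \<in> P" using z by (force simp: P_def Z_def PiE_iff abs_le_iff)
  qed
  show "finite Z" using ZP finP by (rule finite_subset)
  have "real (card Z) = (\<Sum>z\<in>Z. 1)" by simp
  also have "\<dots> \<le> (\<Sum>z\<in>Z. 2 ^ L * (\<Prod>l<d. (1 / 2) ^ nat \<bar>z l\<bar>))"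
  proof (rule sum_mono)
    fix z assume z: "z \<in> Z"
    have "int (\<Sum>l<d. nat \<bar>z l\<bar>) \<le> int L" using z by (simp add: Z_def L_def)
    then have "(\<Sum>l<d. nat \<bar>z l\<bar>) \<le> L" by (simp only: of_nat_le_iff)
    then have "(1 / 2 :: real) ^ L \<le> (1 / 2) ^ (\<Sum>l<d. nat \<bar>z l\<bar>)" by (intro power_decreasing) auto
    then have "(2 :: real) ^ L * (1 / 2) ^ L \<le> 2 ^ L * (1 / 2) ^ (\<Sum>l<d. nat \<bar>z l\<bar>)"
      by (rule mult_left_mono) simp
    then show "(1 :: real) \<le> 2 ^ L * (\<Prod>l<d. (1 / 2) ^ nat \<bar>z l\<bar>)"
      by (simp only: power_sum power_mult_distrib [symmetric]) simp
  qed
  \<comment> \<open>Passing from \<open>Z\<close> to the box \<open>P\<close> makes the weighted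
    count a product of one-dimensional sums.\<close>
  also have "\<dots> \<le> (\<Sum>z\<in>P. 2 ^ L * (\<Prod>l<d. (1 / 2) ^ nat \<bar>z l\<bar>))"
    using finP ZP by (intro sum_mono2) (auto intro!: mult_nonneg_nonneg prod_nonneg)
  also have "\<dots> = 2 ^ L * (\<Prod>l<d. \<Sum>v\<in>{- int L..int L}. (1 / 2) ^ nat \<bar>v\<bar>)"
    unfolding P_def by (subst prod_sum_PiE) (auto simp: sum_distrib_left)
  also have "\<dots> \<le> 2 ^ L * (\<Prod>l<d. 3)"
  proof -
    have "0 \<le> (1 / 2 :: real) ^ L" "(1 / 2 :: real) ^ L \<le> 1" by (simp_all add: power_le_one)
    then have "0 \<le> 3 - 2 * (1 / 2 :: real) ^ L \<and> 3 - 2 * (1 / 2 :: real) ^ L \<le> 3" by linarith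
    then show ?thesis unfolding sum_half_power_abs by (intro mult_left_mono prod_mono) auto
  qed
  also have "\<dots> = real ((3 * 2 ^ B) ^ d)"
    by (simp add: L_def power_mult power_mult_distrib)
  finally show "card Z \<le> (3 * 2 ^ B) ^ d" by (simp only: of_nat_le_iff)
qed

text \<open>Half-open cubes of side \<open>\<eta> / sqrt d\<close>, whose diagonal is
  \<open>\<eta>\<close>. Restricting the index to \<open>{..<d}\<close> puts the cells into an
  extensional function space, where they can be counted.\<close>

definition grid_cell :: "nat \<Rightarrow> real \<Rightarrow> (nat \<Rightarrow> real) \<Rightarrow> nat \<Rightarrow> int" where
  "grid_cell d \<eta> y = (\<lambda>l\<in>{..<d}. \<lfloor>y l * sqrt d / \<eta>\<rfloor>)"

lemma edist_same_cell:
  assumes d: "d \<ge> 1" and \<eta>: "\<eta> > 0" and eq: "grid_cell d \<eta> y = grid_cell d \<eta> z"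
  shows "edist d y z \<le> \<eta>"
proof -
  have sq: "(y l - z l)\<^sup>2 \<le> \<eta>\<^sup>2 / d" if "l < d" for l
  proof -
    have "\<lfloor>y l * sqrt d / \<eta>\<rfloor> = \<lfloor>z l * sqrt d / \<eta>\<rfloor>"
      using fun_cong[OF eq, of l] that by (simp add: grid_cell_def)
    then have "\<bar>y l * sqrt d / \<eta> - z l * sqrt d / \<eta>\<bar> \<le> 1" by linarith
    also have "y l * sqrt d / \<eta> - z l * sqrt d / \<eta> = (y l - z l) * (sqrt d / \<eta>)"
      by (simp add: left_diff_distrib diff_divide_distrib)
    finally have "((y l - z l) * (sqrt d / \<eta>))\<^sup>2 \<le> 1" by (simp add: abs_square_le_1)
    moreover have "((y l - z l) * (sqrt d / \<eta>))\<^sup>2 = (y l - z l)\<^sup>2 * (d / \<eta>\<^sup>2)"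
      by (simp add: power_mult_distrib power_divide)
    ultimately have "(y l - z l)\<^sup>2 * (d / \<eta>\<^sup>2) \<le> 1" by simp
    then show ?thesis using d \<eta> by (simp add: field_simps)
  qed
  have "(\<Sum>l<d. (y l - z l)\<^sup>2) \<le> (\<Sum>l<d. \<eta>\<^sup>2 / d)" by (intro sum_mono sq) auto
  also have "\<dots> = \<eta>\<^sup>2" using d by simp
  finally show ?thesis using \<eta> by (simp add: edist_def L2_set_def real_le_lsqrt sum_nonneg)
qed

text \<open>The bound is linear in \<open>d\<close>, with \<open>B\<close> depending only on
  \<open>R\<close> and \<open>\<eta>\<close>. This keeps the number of cells exponential in
  \<open>d\<close> with a base independent of \<open>d\<close>.\<close>

lemma grid_cell_bound:
  assumes d: "d \<ge> 1" and \<eta>: "\<eta> > 0" and y: "(\<Sum>l<d. (y l)\<^sup>2) \<le> R" and B: "(1 + R) / \<eta> + 1 \<le> real B"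
  shows "grid_cell d \<eta> y \<in> {z \<in> {..<d} \<rightarrow>\<^sub>E UNIV. (\<Sum>l<d. \<bar>z l\<bar>) \<le> int (B * d)}"
proof -
  have "real_of_int \<bar>grid_cell d \<eta> y l\<bar> \<le> (1 + d * (y l)\<^sup>2) / \<eta> + 1" if "l < d" for l
  proof -
    have cell: "grid_cell d \<eta> y l = \<lfloor>y l * sqrt d / \<eta>\<rfloor>" using that by (simp add: grid_cell_def)
    have "real_of_int \<bar>grid_cell d \<eta> y l\<bar> \<le> \<bar>y l * sqrt d / \<eta>\<bar> + 1"
      unfolding cell by linarith
    also have "\<bar>y l * sqrt d / \<eta>\<bar> = \<bar>y l * sqrt d\<bar> / \<eta>" using \<eta> by simp
    \<comment> \<open>Trading the absolute value for a square brings in the Euclidean bound; the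
      constants and the squares both sum to multiples of \<open>d\<close>.\<close>
    also have "\<bar>y l * sqrt d\<bar> \<le> 1 + (y l * sqrt d)\<^sup>2"
    proof -
      have "0 \<le> (\<bar>y l * sqrt d\<bar> - 1)\<^sup>2" by simp
      also have "\<dots> = (y l * sqrt d)\<^sup>2 + 1 - 2 * \<bar>y l * sqrt d\<bar>"
        by (simp add: power2_diff)
      finally show ?thesis by linarith
    qed
    also have "(y l * sqrt d)\<^sup>2 = d * (y l)\<^sup>2" by (simp add: power_mult_distrib)
    finally show ?thesis using \<eta> by (simp add: divide_right_mono)
  qed
  then have "(\<Sum>l<d. real_of_int \<bar>grid_cell d \<eta> y l\<bar>) \<le> (\<Sum>l<d. (1 + d * (y l)\<^sup>2) / \<eta> + 1)"
    by (intro sum_mono) auto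
  also have "\<dots> = (d + d * (\<Sum>l<d. (y l)\<^sup>2)) / \<eta> + d"
    by (simp add: sum.distrib sum_distrib_left sum_divide_distrib [symmetric])
  also have "\<dots> \<le> (d + d * R) / \<eta> + d"
    using y \<eta> by (intro add_right_mono divide_right_mono add_left_mono mult_left_mono) auto
  also have "\<dots> = d * ((1 + R) / \<eta> + 1)" by (simp add: algebra_simps add_divide_distrib)
  also have "\<dots> \<le> real d * real B" using B by (intro mult_left_mono) auto
  finally have "real_of_int (\<Sum>l<d. \<bar>grid_cell d \<eta> y l\<bar>) \<le> real_of_int (int (B * d))" by (simp add: mult.commute)
  then have "(\<Sum>l<d. \<bar>grid_cell d \<eta> y l\<bar>) \<le> int (B * d)" by (simp only: of_int_le_iff)
  then show ?thesis by (simp add: grid_cell_def)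
qed

text \<open>A point of squared norm at most \<open>R\<close> is represented by the first such point
  in its cell, any other point by itself. Hence a fixed point of \<open>rep\<close> is either an
  outlier or the first point of norm at most \<open>sqrt R\<close> in its cell.\<close>

lemma exists_representatives:
  fixes h :: "nat \<Rightarrow> nat \<Rightarrow> real" and \<eta> R :: real
  assumes d: "d \<ge> 1" and \<eta>: "\<eta> > 0" and B: "(1 + R) / \<eta> + 1 \<le> real B"
  shows "\<exists>rep. (\<forall>i. rep i \<le> i) \<and> (\<forall>i. rep i < i \<longrightarrow> edist d (h i) (h (rep i)) \<le> \<eta>) \<and>
    card {i. i < N \<and> rep i = i} \<le> card {i. i < N \<and> (\<Sum>l<d. (h i l)\<^sup>2) > R} + (3 * 2 ^ B) ^ d"
proof -
  define good where "good i \<longleftrightarrow> (\<Sum>l<d. (h i l)\<^sup>2) \<le> R" for i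
  define z where "z i = grid_cell d \<eta> (h i)" for i
  define rep where "rep i = (if good i then LEAST j. good j \<and> z j = z i else i)" for i
  have rep_le: "rep i \<le> i" for i by (auto simp: rep_def intro: Least_le)
  have rep_z: "z (rep i) = z i" for i
    using LeastI[of "\<lambda>j. good j \<and> z j = z i" i] by (auto simp: rep_def)
  define Z where "Z = {z \<in> {..<d} \<rightarrow>\<^sub>E (UNIV :: int set). (\<Sum>l<d. \<bar>z l\<bar>) \<le> int (B * d)}"
  have inj: "inj_on z {i. i < N \<and> good i \<and> rep i = i}"
    by (rule inj_onI) (auto simp: rep_def)
  have zZ: "z ` {i. i < N \<and> good i \<and> rep i = i} \<subseteq> Z"
    using grid_cell_bound[OF d \<eta> _ B] by (auto simp: z_def Z_def good_def)
  have "card {i. i < N \<and> good i \<and> rep i = i} \<le> card Z"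
    using inj zZ card_lattice_points(1)[of d B] unfolding Z_def by (rule card_inj_on_le)
  also have "\<dots> \<le> (3 * 2 ^ B) ^ d" unfolding Z_def by (rule card_lattice_points(2))
  finally have c: "card {i. i < N \<and> good i \<and> rep i = i} \<le> (3 * 2 ^ B) ^ d" .
  have "card {i. i < N \<and> rep i = i} \<le>
      card ({i. i < N \<and> (\<Sum>l<d. (h i l)\<^sup>2) > R} \<union> {i. i < N \<and> good i \<and> rep i = i})"
    by (rule card_mono) (auto simp: good_def)
  also have "\<dots> \<le> card {i. i < N \<and> (\<Sum>l<d. (h i l)\<^sup>2) > R} + card {i. i < N \<and> good i \<and> rep i = i}"
    by (rule card_Un_le)
  finally show ?thesis
    using rep_le rep_z edist_same_cell[OF d \<eta>] c unfolding z_def by (intro exI[of _ rep]) fastforce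
qed

text \<open>Index \<open>t\<close> stands for position \<open>t mod k\<close> in cluster
  \<open>t div k\<close>. A cluster with an earlier representative is joined to it position by
  position; any other cluster is a path whose first point hangs off index 0.\<close>

definition cluster_parent :: "nat \<Rightarrow> (nat \<Rightarrow> nat) \<Rightarrow> nat \<Rightarrow> nat" where
  "cluster_parent k rep t =
    (if rep (t div k) < t div k then rep (t div k) * k + t mod k
     else if t mod k > 0 then t - 1 else 0)"

text \<open>Moving to the same position of an earlier cluster lowers the index, as does a step along
  a path. The identity is therefore a rank.\<close>

lemma cluster_parent_less:
  assumes "k > 0" "t > 0"
  shows "cluster_parent k rep t < t"
proof -
  have "a * k + t mod k < t" if "a < t div k" for a
  proof -
    have "a * k < t div k * k" using that assms by simp
    then have "a * k + t mod k < t div k * k + t mod k" by (rule add_strict_right_mono)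
    then show ?thesis by (simp only: div_mult_mod_eq)
  qed
  then show ?thesis using assms by (auto simp: cluster_parent_def)
qed

lemma parent_graph_cluster:
  assumes "k > 0" "n > 0"
  shows "parent_graph {..<n} 0 (cluster_parent k rep) id"
proof
  show "cluster_parent k rep y \<in> {..<n}" if "y \<in> {..<n}" "y \<noteq> 0" for y
    using cluster_parent_less[of k y rep] that assms by auto
qed (use assms cluster_parent_less in auto)

text \<open>\<open>\<eta>\<close> pays for edges between a cluster and its representative,
  \<open>\<alpha>\<close> for path edges inside clusters that represent themselves, and
  \<open>\<beta>\<close> for edges from first points to index 0. \<open>N\<close> counts the
  clusters, the last of which may be incomplete.\<close>

lemma wcost_cluster_tree:
  fixes w :: "nat \<Rightarrow> nat \<Rightarrow> real" and \<alpha> \<eta> :: real and \<beta> :: "nat \<Rightarrow> real"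
  assumes k: "k > 0" and n: "n > 0" and sym: "\<And>u v. w u v = w v u"
    and nonneg: "\<alpha> \<ge> 0" "\<eta> \<ge> 0" "\<And>i. \<beta> i \<ge> 0"
    and rep: "\<And>i. rep i \<le> i"
    and w1: "\<And>t. t < n \<Longrightarrow> rep (t div k) < t div k \<Longrightarrow> w t (rep (t div k) * k + t mod k) \<le> \<eta>"
    and w2: "\<And>t. t < n \<Longrightarrow> t mod k > 0 \<Longrightarrow> w t (t - 1) \<le> \<alpha>"
    and w3: "\<And>t. t < n \<Longrightarrow> t mod k = 0 \<Longrightarrow> w t 0 \<le> \<beta> (t div k)"
  defines "N \<equiv> (n - 1) div k + 1"
  shows "wcost w (parent_tree {..<n} 0 (cluster_parent k rep)) \<le>
    real n * \<eta> + real (card {i. i < N \<and> rep i = i}) * real k * \<alpha> + (\<Sum>i<N. \<beta> i)"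
proof -
  interpret parent_graph "{..<n}" 0 "cluster_parent k rep" id
    by (rule parent_graph_cluster[OF k n])
  let ?S = "{i. i < N \<and> rep i = i}"
  have divN: "t div k < N" if "t < n" for t
    using that unfolding N_def by (simp add: div_le_mono less_Suc_eq_le)
  have "wcost w (parent_tree {..<n} 0 (cluster_parent k rep)) =
      (\<Sum>t\<in>{..<n} - {0}. w t (cluster_parent k rep t))"
    by (rule wcost_parent) (use sym in auto)
  \<comment> \<open>The charges overlap: \<open>\<eta>\<close> is charged to every vertex and
    \<open>\<beta>\<close> to every first point, whether or not that kind of edge occurs
    there.\<close>
  also have "\<dots> \<le> (\<Sum>t\<in>{..<n} - {0}. \<eta> + (if t div k \<in> ?S then \<alpha> else 0) +
      (if t mod k = 0 then \<beta> (t div k) else 0))"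
  proof (rule sum_mono)
    fix t assume "t \<in> {..<n} - {0}"
    then have t: "t < n" "t > 0" by auto
    show "w t (cluster_parent k rep t) \<le> \<eta> + (if t div k \<in> ?S then \<alpha> else 0) +
      (if t mod k = 0 then \<beta> (t div k) else 0)"
      using w1[OF t(1)] w2[OF t(1)] w3[OF t(1)] nonneg(1,2) nonneg(3)[of "t div k"] divN[OF t(1)] rep[of "t div k"]
      by (auto simp: cluster_parent_def)
  qed
  also have "\<dots> \<le> (\<Sum>t<n. \<eta> + (if t div k \<in> ?S then \<alpha> else 0) + (if t mod k = 0 then \<beta> (t div k) else 0))"
    using nonneg by (intro sum_mono2) auto
  also have "\<dots> = n * \<eta> + card {t. t < n \<and> t div k \<in> ?S} * \<alpha> + (\<Sum>t | t < n \<and> t mod k = 0. \<beta> (t div k))"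
    by (simp add: sum.distrib sum.If_cases Int_def)
  also have "card {t. t < n \<and> t div k \<in> ?S} \<le> card ?S * k"
  proof -
    have "{t. t < n \<and> t div k \<in> ?S} \<subseteq> (\<lambda>(i, j). i * k + j) ` (?S \<times> {..<k})"
    proof
      fix t assume "t \<in> {t. t < n \<and> t div k \<in> ?S}"
      then show "t \<in> (\<lambda>(i, j). i * k + j) ` (?S \<times> {..<k})"
        using k by (intro image_eqI[of _ _ "(t div k, t mod k)"]) auto
    qed
    then have "card {t. t < n \<and> t div k \<in> ?S} \<le> card (?S \<times> {..<k})"
      by (intro surj_card_le) auto
    then show ?thesis by (simp add: card_cartesian_product)
  qed
  \<comment> \<open>Division by \<open>k\<close> is injective on multiples of \<open>k\<close>, so
    each cluster is charged \<open>\<beta>\<close> at most once.\<close>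
  also have "(\<Sum>t | t < n \<and> t mod k = 0. \<beta> (t div k)) = (\<Sum>i\<in>(\<lambda>t. t div k) ` {t. t < n \<and> t mod k = 0}. \<beta> i)"
    by (subst sum.reindex) (auto intro!: inj_onI simp: o_def dvd_eq_mod_eq_0 [symmetric] dvd_div_eq_iff)
  also have "\<dots> \<le> (\<Sum>i<N. \<beta> i)"
    using divN nonneg(3) by (intro sum_mono2) auto
  finally show ?thesis using nonneg(1) by (simp add: mult_right_mono)
qed

section \<open>The point set\<close>

lemma div_less_bound: "t < n \<Longrightarrow> t div k < (n :: nat)"
  by (rule le_less_trans[OF div_le_dividend])

lemma L2_set_scale: "L2_set (\<lambda>l. c * f l) I = \<bar>c\<bar> * L2_set f I"
  by (simp add: L2_set_def power_mult_distrib sum_distrib_left [symmetric] real_sqrt_mult)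

lemma L2_set_single:
  assumes "finite I" "a \<in> I" "\<And>q. q \<in> I \<Longrightarrow> q \<noteq> a \<Longrightarrow> f q = 0"
  shows "L2_set f I = \<bar>f a\<bar>"
proof -
  have "(\<Sum>q\<in>I. (f q)\<^sup>2) = (f a)\<^sup>2"
    using assms by (subst sum.remove[of I a]) auto
  then show ?thesis by (simp add: L2_set_def)
qed

lemma edist_commute: "edist k u v = edist k v u"
  by (simp add: edist_def L2_set_def power2_commute)

lemma edist_triangle: "edist k u w \<le> edist k u v + edist k v w"
  using L2_set_triangle_ineq[of "\<lambda>i. u i - v i" "\<lambda>i. v i - w i" "{..<k}"] by (simp add: edist_def)

lemma coordinate_le_edist: "q < k \<Longrightarrow> \<bar>u q - v q\<bar> \<le> edist k u v"
  using member_le_L2_set[of "{..<k}" q "\<lambda>i. \<bar>u i - v i\<bar>"] by (simp add: edist_def L2_set_def)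

text \<open>Coordinate 0 is reserved for the position inside the cluster and is tested first, which
  places cluster 0 at the origin. As \<open>t div k < n\<close> for \<open>t < n\<close>, dimension
  \<open>n\<close> suffices for \<open>n\<close> points.\<close>

definition cluster_point :: "nat \<Rightarrow> real \<Rightarrow> nat \<Rightarrow> nat \<Rightarrow> real" where
  "cluster_point k \<delta> t =
    (\<lambda>q. if q = 0 then \<delta> * real (t mod k) else if q = t div k then 1 else 0)"

lemma cluster_point_0 [simp]: "cluster_point k \<delta> t 0 = \<delta> * real (t mod k)"
  by (simp add: cluster_point_def)

lemma cluster_point_eq_0: "t < n \<Longrightarrow> n \<le> q \<Longrightarrow> cluster_point k \<delta> t q = 0"
  using div_less_bound[of t n k] by (auto simp: cluster_point_def)

lemma edist_cluster_point_same:
  assumes "n > 0" "t div k = t' div k"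
  shows "edist n (cluster_point k \<delta> t) (cluster_point k \<delta> t') = \<bar>\<delta> * (real (t mod k) - real (t' mod k))\<bar>"
  unfolding edist_def
  by (subst L2_set_single[of _ 0]) (use assms in \<open>auto simp: cluster_point_def algebra_simps\<close>)

text \<open>One of the two cluster numbers is nonzero, and in that coordinate one point has entry 1
  and the other 0.\<close>

lemma edist_cluster_point_cross:
  assumes "t < n" "t' < n" "t div k \<noteq> t' div k"
  shows "1 \<le> edist n (cluster_point k \<delta> t) (cluster_point k \<delta> t')"
proof -
  have *: "1 \<le> edist n (cluster_point k \<delta> t) (cluster_point k \<delta> t')"
    if "t < n" "t div k \<noteq> t' div k" "t div k \<noteq> 0" for t t'
    using coordinate_le_edist[of "t div k" n "cluster_point k \<delta> t" "cluster_point k \<delta> t'"]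
      that div_less_bound[of t n k] by (simp add: cluster_point_def)
  show ?thesis
  proof (cases "t div k = 0")
    case True
    then show ?thesis using *[of t' t] assms by (metis edist_commute)
  qed (use * assms in simp)
qed

lemma edist_cluster_point_root:
  assumes "t < n" "t mod k = 0"
  shows "edist n (cluster_point k \<delta> t) (cluster_point k \<delta> 0) \<le> 1"
  unfolding edist_def
  by (subst L2_set_single[of _ "t div k"])
     (use assms div_less_bound[of t n k] in \<open>auto simp: cluster_point_def\<close>)

lemma inj_cluster_point:
  assumes "\<delta> > 0"
  shows "inj_on (cluster_point k \<delta>) {..<n}"
proof (rule inj_onI)
  fix t t' assume t: "t \<in> {..<n}" "t' \<in> {..<n}" and eq: "cluster_point k \<delta> t = cluster_point k \<delta> t'"
  have "edist n (cluster_point k \<delta> t) (cluster_point k \<delta> t') = 0"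
    by (simp add: eq edist_def L2_set_def)
  then have "t div k = t' div k" using edist_cluster_point_cross[of t n t' k \<delta>] t by auto
  moreover have "t mod k = t' mod k"
    using fun_cong[OF eq, of 0] assms by simp
  ultimately show "t = t'" by (metis div_mult_mod_eq)
qed

text \<open>The comparison tree runs along each cluster in steps of \<open>\<delta>\<close> and
  joins its first point to the origin at cost at most 1.\<close>

lemma mst_cost_cluster_points:
  assumes n: "n > 0" and k: "k > 0" and \<delta>: "\<delta> > 0"
  shows "mst_cost n (cluster_point k \<delta> ` {..<n}) \<le> real ((n - 1) div k + 1) * (k * \<delta> + 1)"
proof -
  let ?x = "cluster_point k \<delta>" and ?T = "parent_tree {..<n} 0 (cluster_parent k (\<lambda>i. i))"
  interpret parent_graph "{..<n}" 0 "cluster_parent k (\<lambda>i. i)" id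
    by (rule parent_graph_cluster[OF k n])
  have inj: "inj_on ?x {..<n}" using \<delta> by (rule inj_cluster_point)
  have "mst_cost n (?x ` {..<n}) \<le> tree_cost n ((`) ?x ` ?T)"
    unfolding mst_cost_def using spanning_tree_image[OF spanning_tree_parent inj]
    by (intro Min_le finite_imageI finite_spanning_trees) auto
  also have "\<dots> = wcost (\<lambda>u v. edist n (?x u) (?x v)) ?T"
    by (simp add: tree_cost_eq_wcost wcost_image[OF spanning_tree_parent inj])
  \<comment> \<open>With \<open>rep\<close> the identity no clusters are joined to each other, so
    the joining cost is 0.\<close>
  also have "\<dots> \<le> real n * 0 + real (card {i. i < (n - 1) div k + 1 \<and> i = i}) * real k * \<delta> + (\<Sum>i<(n - 1) div k + 1. 1)"
  proof (rule wcost_cluster_tree[OF k n])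
    fix t assume t: "t < n" "0 < t mod k"
    then have "t > 0" by (metis mod_0 neq0_conv)
    then obtain t' where t': "t = Suc t'" by (cases t) auto
    \<comment> \<open>As \<open>t\<close> is not the first point of its cluster, its predecessor
      lies in the same cluster.\<close>
    have "t' div k = t div k \<and> t' mod k = t mod k - 1"
      using t(2) unfolding t' by (auto simp: mod_Suc div_Suc split: if_splits)
    then show "edist n (?x t) (?x (t - 1)) \<le> \<delta>"
      using edist_cluster_point_same[OF n, of t k "t - 1" \<delta>] t(2) t' \<delta> by simp
  qed (use \<delta> edist_commute edist_cluster_point_root in auto)
  also have "\<dots> = real ((n - 1) div k + 1) * (k * \<delta> + 1)"
    by (simp add: algebra_simps)
  finally show ?thesis .
qed

text \<open>All points together serve as centres for the upper bound. For the lower one, the first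
  points of the clusters other than cluster 0 lie in the unit ball about the origin at mutual
  distance \<open>sqrt 2\<close>, so no ball of radius 1/2 contains two of them.\<close>

lemma doubling_const_cluster_points:
  assumes n: "n > 0" and k: "k > 0" and \<delta>: "\<delta> > 0"
  shows "doubling_const n (cluster_point k \<delta> ` {..<n}) \<le> n"
    and "(n - 1) div k \<le> doubling_const n (cluster_point k \<delta> ` {..<n})"
proof -
  let ?x = "cluster_point k \<delta>"
  let ?X = "?x ` {..<n}"
  define P where "P l \<longleftrightarrow> (\<forall>x\<in>?X. \<forall>r>0. \<exists>S\<subseteq>?X. finite S \<and> card S \<le> l \<and>
     rel_ball n ?X x r \<subseteq> (\<Union>s\<in>S. rel_ball n ?X s (r / 2)))" for l
  have dc: "doubling_const n ?X = (LEAST l. P l)" by (simp add: doubling_const_def P_def)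
  have Pn: "P n"
    unfolding P_def
  proof (intro ballI allI impI exI[of _ ?X] conjI)
    show "card ?X \<le> n" using card_image_le[of "{..<n}" ?x] by simp
    show "rel_ball n ?X x r \<subseteq> (\<Union>s\<in>?X. rel_ball n ?X s (r / 2))" if "r > 0" for x r
      using that by (force simp: rel_ball_def edist_def L2_set_def)
  qed auto
  show "doubling_const n ?X \<le> n" unfolding dc using Pn by (rule Least_le)
  have "P (doubling_const n ?X)" unfolding dc using Pn by (rule LeastI)
  moreover have "?x 0 \<in> ?X" using n by auto
  ultimately obtain S where S: "finite S" "card S \<le> doubling_const n ?X"
    "rel_ball n ?X (?x 0) 1 \<subseteq> (\<Union>s\<in>S. rel_ball n ?X s (1 / 2))"
    unfolding P_def by (meson zero_less_one)
  \<comment> \<open>Cluster 0 is left out because its first point is the origin, at distance only 1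
    from the others. The upper end is the last cluster number with an index below
    \<open>n\<close>.\<close>
  define I where "I = {1..(n - 1) div k}"
  have ik: "i * k < n" "(i * k) div k = i" "(i * k) mod k = 0" if "i \<in> I" for i
  proof -
    have "i * k \<le> (n - 1) div k * k" using that by (intro mult_right_mono) (auto simp: I_def)
    also have "\<dots> \<le> n - 1" by simp
    finally show "i * k < n" using n by linarith
  qed (use k in auto)
  have "\<exists>s\<in>S. edist n s (?x (i * k)) \<le> 1 / 2" if "i \<in> I" for i
  proof -
    have "?x (i * k) \<in> rel_ball n ?X (?x 0) 1"
      using ik[OF that] edist_cluster_point_root[of "i * k" n k \<delta>]
      by (simp add: rel_ball_def edist_commute)
    then show ?thesis using S(3) by (auto simp: rel_ball_def)
  qed
  then obtain c where c: "\<And>i. i \<in> I \<Longrightarrow> c i \<in> S \<and> edist n (c i) (?x (i * k)) \<le> 1 / 2" by metis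
  have "inj_on c I"
  proof (rule inj_onI, rule ccontr)
    fix i j assume ij: "i \<in> I" "j \<in> I" "c i = c j" "i \<noteq> j"
    have "edist n (?x (i * k)) (?x (j * k)) \<le> edist n (?x (i * k)) (c i) + edist n (c i) (?x (j * k))"
      by (rule edist_triangle)
    also have "\<dots> \<le> 1 / 2 + 1 / 2"
      using c[OF ij(1)] c[OF ij(2)] ij(3) by (intro add_mono) (auto simp: edist_commute)
    finally have "edist n (?x (i * k)) (?x (j * k)) \<le> 1" by simp
    \<comment> \<open>The coordinates \<open>i\<close> and \<open>j\<close> alone contribute 2 to
      the squared distance, against the bound 1.\<close>
    moreover have "(\<Sum>q\<in>{i, j}. (?x (i * k) q - ?x (j * k) q)\<^sup>2) \<le> (edist n (?x (i * k)) (?x (j * k)))\<^sup>2"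
    proof -
      have "i \<le> i * k" "j \<le> j * k" using k by auto
      then have "{i, j} \<subseteq> {..<n}" using ik(1)[OF ij(1)] ik(1)[OF ij(2)]
        by (simp only: insert_subset empty_subsetI lessThan_iff simp_thms le_less_trans)
      then show ?thesis unfolding edist_def L2_set_def by (simp add: sum_nonneg sum_mono2)
    qed
    moreover have "(\<Sum>q\<in>{i, j}. (?x (i * k) q - ?x (j * k) q)\<^sup>2) = 2"
      using ij ik by (simp add: cluster_point_def I_def)
    ultimately show False
      using power_mono[of "edist n (?x (i * k)) (?x (j * k))" 1 2]
      by (simp add: edist_def)
  qed
  then have "card I \<le> card S" using c S(1) by (intro card_inj_on_le[of c]) auto
  then show "(n - 1) div k \<le> doubling_const n ?X" using S(2) by (simp add: I_def)
qed

text \<open>The projected centre of cluster \<open>i\<close>: a column of the matrix, or 0 for the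
  cluster placed at the origin.\<close>

definition center :: "(nat \<times> nat \<Rightarrow> real) \<Rightarrow> nat \<Rightarrow> nat \<Rightarrow> real" where
  "center A i = (\<lambda>l. if i = 0 then 0 else A (l, i))"

lemma lin_map_cluster_point:
  assumes "t < n" "l < d"
  shows "lin_map d n A (cluster_point k \<delta> t) l = \<delta> * real (t mod k) * A (l, 0) + center A (t div k) l"
proof -
  \<comment> \<open>For \<open>t div k = 0\<close> both terms sit at \<open>q = 0\<close>, and the
    second vanishes by the choice of \<open>center A 0\<close>.\<close>
  have "(\<Sum>q<n. A (l, q) * cluster_point k \<delta> t q) =
      (\<Sum>q<n. (if q = 0 then \<delta> * real (t mod k) * A (l, 0) else 0) +
        (if q = t div k then center A (t div k) l else 0))"
    by (intro sum.cong) (auto simp: cluster_point_def center_def)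
  also have "\<dots> = \<delta> * real (t mod k) * A (l, 0) + center A (t div k) l"
    using assms div_less_bound[of t n k] by (simp add: sum.distrib)
  finally show ?thesis using assms by (simp add: lin_map_def)
qed

text \<open>Inside a cluster the centre cancels, so projection scales all distances by the norm of
  column 0.\<close>

lemma edist_lin_map_same_cluster:
  assumes "t < n" "t' < n" "t div k = t' div k"
  shows "edist d (lin_map d n A (cluster_point k \<delta> t)) (lin_map d n A (cluster_point k \<delta> t')) =
    \<bar>\<delta> * (real (t mod k) - real (t' mod k))\<bar> * L2_set (\<lambda>l. A (l, 0)) {..<d}"
  unfolding edist_def L2_set_scale [symmetric]
  by (intro L2_set_cong refl) (use assms in \<open>simp add: lin_map_cluster_point algebra_simps\<close>)

text \<open>Equal positions cancel, so one comparison of centres prices all the edges that join two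
  clusters pointwise.\<close>

lemma edist_lin_map_same_offset:
  assumes "t < n" "t' < n" "t mod k = t' mod k"
  shows "edist d (lin_map d n A (cluster_point k \<delta> t)) (lin_map d n A (cluster_point k \<delta> t')) =
    edist d (center A (t div k)) (center A (t' div k))"
  unfolding edist_def
  by (intro L2_set_cong refl) (use assms in \<open>simp add: lin_map_cluster_point\<close>)

text \<open>A cluster costs at most \<open>s + 1 \<le> 2 * s\<close>, and there are at most
  \<open>2 * n / s\<^sup>2\<close> clusters, because \<open>n \<ge> s\<^sup>2\<close> absorbs the
  incomplete one.\<close>

lemma mst_cost_bound:
  fixes s n :: nat
  assumes s: "s \<ge> 1" and n: "s\<^sup>2 \<le> n"
  shows "mst_cost n (cluster_point (s\<^sup>2) (1 / s) ` {..<n}) \<le> 4 * n / s"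
proof -
  define k where "k = s\<^sup>2"
  define N where "N = (n - 1) div k + 1"
  have k: "k > 0" using s by (simp add: k_def)
  have n_pos: "n > 0" using k n k_def by linarith
  have "(n - 1) div k * k \<le> n - 1" by (rule div_times_less_eq_dividend)
  moreover have "N * k = (n - 1) div k * k + k" by (simp add: N_def)
  ultimately have "N * k \<le> 2 * n" using n unfolding k_def by linarith
  then have "real N * real k \<le> 2 * n" by (simp flip: of_nat_mult)
  then have N: "real N * real s \<le> 2 * n / s" using s by (simp add: k_def power2_eq_square field_simps)
  have "mst_cost n (cluster_point (s\<^sup>2) (1 / s) ` {..<n}) \<le> real N * (k * (1 / s) + 1)"
    unfolding N_def k_def using mst_cost_cluster_points[OF n_pos, of "s\<^sup>2" "1 / s"] s by simp
  also have "\<dots> = real N * (s + 1)" using s by (simp add: k_def power2_eq_square)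
  also have "\<dots> \<le> real N * (2 * s)" using s by (intro mult_left_mono) auto
  also have "\<dots> \<le> 4 * n / s" using N by simp
  finally show ?thesis .
qed

section \<open>Minimum spanning trees of the projected points\<close>

text \<open>
  Below, \<open>B\<close> bounds the grid coordinates of \<open>G e\<^sub>i\<close> in the mean, for cells of size \<open>1/(1024 s)\<close> and
  \<open>|G e\<^sub>i|\<^sup>2 \<le> 200000\<close>; there are at most \<open>(3 * 2 ^ B) ^ d\<close> such cells. The threshold for \<open>s\<close> makes
  the cost \<open>O(n / s\<^sup>2)\<close> of joining the clusters at most \<open>n / (1024 s)\<close>.
\<close>

locale projected_clusters =
  fixes s n d :: nat and A :: "nat \<times> nat \<Rightarrow> real"
  assumes s: "s \<ge> 26624" and d: "d \<ge> 1"
    and n: "8192 * s\<^sup>2 * (3 * 2 ^ (200001 * 1024 * s + 1)) ^ d \<le> n"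
    and A0: "(\<Sum>l<d. (A (l, 0))\<^sup>2) > (1 / 32)\<^sup>2"
    and A1: "(\<Sum>l<d. (A (l, 0))\<^sup>2) < 12"
    and A2: "(\<Sum>i<(n - 1) div s\<^sup>2 + 1. \<Sum>l<d. (A (l, i))\<^sup>2) < 12 * real ((n - 1) div s\<^sup>2 + 1)"
begin

definition "k = s\<^sup>2"
definition "\<delta> = 1 / real s"
definition "x = cluster_point k \<delta>"
definition "N = (n - 1) div k + 1"
definition "B = 200001 * 1024 * s + 1"
definition "wG = (\<lambda>u v. edist d (lin_map d n A (x u)) (lin_map d n A (x v)))"

lemma k: "k > 0" and \<delta>: "\<delta> > 0"
  using s by (auto simp: k_def \<delta>_def)

lemma cells_le: "8192 * (k * (3 * 2 ^ B) ^ d) \<le> n"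
  using n by (simp only: k_def B_def mult.assoc)

lemma k_le: "8192 * k \<le> n"
proof -
  have "k * 1 \<le> k * (3 * 2 ^ B) ^ d" by (intro mult_left_mono) auto
  then show ?thesis using cells_le by linarith
qed

lemma n_ge: "n \<ge> 8192" and n_pos: "n > 0"
  using k k_le by linarith+

lemma clusters_le: "N * k \<le> 2 * n"
proof -
  have "(n - 1) div k * k \<le> n - 1" by (rule div_times_less_eq_dividend)
  moreover have "N * k = (n - 1) div k * k + k" by (simp add: N_def)
  ultimately show ?thesis using k_le by linarith
qed

text \<open>This norm is the factor by which projection scales every cluster; the two bounds fix the
  price of an edge inside a cluster up to constants.\<close>

lemma column_norm_bounds:
  defines "U \<equiv> L2_set (\<lambda>l. A (l, 0)) {..<d}"
  shows "1 / 32 \<le> U" "U \<le> 4"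
  unfolding U_def L2_set_def
  using real_le_rsqrt[OF less_imp_le[OF A0]] real_le_lsqrt[of 4 "\<Sum>l<d. (A (l, 0))\<^sup>2"] A1 by auto

text \<open>The competitor is the cluster tree built from representatives. Its joining edges, its
  path edges and its edges to the root each cost at most \<open>n / (1024 * s)\<close> in
  total.\<close>

lemma minimal_tree_cost_bound:
  assumes S: "spanning_tree {..<n} S"
    and minimal: "\<And>S'. spanning_tree {..<n} S' \<Longrightarrow> wcost wG S \<le> wcost wG S'"
  shows "wcost wG S \<le> 3 * n / (1024 * s)"
proof -
  define \<eta> where "\<eta> = 1 / (1024 * real s)"
  have \<eta>: "\<eta> > 0" using s by (auto simp: \<eta>_def)
  have norm_center: "(\<Sum>l<d. (center A i l)\<^sup>2) \<le> (\<Sum>l<d. (A (l, i))\<^sup>2)" for i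
    by (intro sum_mono) (auto simp: center_def)
  have sum_center: "(\<Sum>i<N. \<Sum>l<d. (center A i l)\<^sup>2) \<le> 12 * N"
    using sum_mono[of "{..<N}" "\<lambda>i. \<Sum>l<d. (center A i l)\<^sup>2", OF norm_center] A2
    by (simp add: N_def k_def)
  \<comment> \<open>Markov's inequality for counting: the squared norms sum to at most
    \<open>12 * N\<close>, so few centres exceed the radius used for the cells.\<close>
  have outliers: "real (card {i. i < N \<and> (\<Sum>l<d. (center A i l)\<^sup>2) > 200000}) * 200000 \<le> 12 * N"
  proof -
    let ?O = "{i. i < N \<and> (\<Sum>l<d. (center A i l)\<^sup>2) > 200000}"
    have "real (card ?O) * 200000 = (\<Sum>i\<in>?O. 200000)" by simp
    also have "\<dots> \<le> (\<Sum>i\<in>?O. \<Sum>l<d. (center A i l)\<^sup>2)" by (intro sum_mono) auto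
    also have "\<dots> \<le> (\<Sum>i<N. \<Sum>l<d. (center A i l)\<^sup>2)" by (intro sum_mono2) (auto intro!: sum_nonneg)
    finally show ?thesis using sum_center by linarith
  qed
  \<comment> \<open>\<open>B\<close> is chosen so that this holds with equality.\<close>
  have "(1 + 200000) / \<eta> + 1 \<le> real B" by (simp add: \<eta>_def B_def)
  from exists_representatives[OF d \<eta> this, of "center A" N] obtain rep where
    rep: "\<And>i. rep i \<le> i" "\<And>i. rep i < i \<Longrightarrow> edist d (center A i) (center A (rep i)) \<le> \<eta>"
    and card_rep: "card {i. i < N \<and> rep i = i} \<le>
      card {i. i < N \<and> (\<Sum>l<d. (center A i l)\<^sup>2) > 200000} + (3 * 2 ^ B) ^ d"
    by blast
  let ?T = "parent_tree {..<n} 0 (cluster_parent k rep)"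
  let ?U = "L2_set (\<lambda>l. A (l, 0)) {..<d}"
  interpret parent_graph "{..<n}" 0 "cluster_parent k rep" id
    by (rule parent_graph_cluster[OF k n_pos])
  have "wcost wG S \<le> wcost wG ?T" using spanning_tree_parent by (rule minimal)
  \<comment> \<open>A path edge has length at most \<open>4 * \<delta>\<close> because column 0 has
    norm at most 4. An edge to the root has length \<open>sqrt c\<close>, and the bound
    \<open>1 + c\<close> leaves squared norms, whose sum is controlled.\<close>
  also have "\<dots> \<le> real n * \<eta> + real (card {i. i < N \<and> rep i = i}) * real k * (4 * \<delta>) +
      (\<Sum>i<N. 1 + (\<Sum>l<d. (center A i l)\<^sup>2))"
    unfolding N_def
  proof (rule wcost_cluster_tree[OF k n_pos])
    fix t assume t: "t < n" "rep (t div k) < t div k"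
    let ?t' = "rep (t div k) * k + t mod k"
    \<comment> \<open>The partner has a smaller index than \<open>t\<close> and is therefore a
      vertex.\<close>
    have "?t' = cluster_parent k rep t" using t by (simp add: cluster_parent_def)
    also have "\<dots> < t" using t(2) k by (intro cluster_parent_less) (auto intro: gr0I)
    finally have "?t' < n" using t by simp
    moreover have "?t' div k = rep (t div k)" "?t' mod k = t mod k" using k by auto
    ultimately show "wG t ?t' \<le> \<eta>"
      using edist_lin_map_same_offset[of t n ?t' k d A \<delta>] rep(2)[OF t(2)] t(1)
      by (simp add: wG_def x_def)
  next
    fix t assume t: "t < n" "0 < t mod k"
    then have "t > 0" by (metis mod_0 neq0_conv)
    then obtain t' where t': "t = Suc t'" by (cases t) auto
    have "t' div k = t div k \<and> t' mod k = t mod k - 1"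
      using t(2) unfolding t' by (auto simp: mod_Suc div_Suc split: if_splits)
    then have "wG t (t - 1) = \<delta> * ?U"
      using edist_lin_map_same_cluster[of t n "t - 1" k d A \<delta>] t t' \<delta>
      by (simp add: wG_def x_def)
    also have "\<dots> \<le> \<delta> * 4" using column_norm_bounds(2) \<delta> by (intro mult_left_mono) auto
    finally show "wG t (t - 1) \<le> 4 * \<delta>" by simp
  next
    fix t assume t: "t < n" "t mod k = 0"
    let ?c = "\<Sum>l<d. (center A (t div k) l)\<^sup>2"
    have c0: "?c \<ge> 0" by (intro sum_nonneg) auto
    have "wG t 0 = edist d (center A (t div k)) (center A 0)"
      using edist_lin_map_same_offset[of t n 0 k d A \<delta>] t n_pos by (simp add: wG_def x_def)
    also have "\<dots> = sqrt ?c" by (simp add: edist_def L2_set_def center_def)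
    also have "\<dots> \<le> 1 + ?c"
    proof (rule real_le_lsqrt)
      have "(1 + ?c)\<^sup>2 = 1 + 2 * ?c + ?c\<^sup>2" by (simp add: power2_sum)
      then show "?c \<le> (1 + ?c)\<^sup>2" using c0 by simp
    qed (use c0 in auto)
    finally show "wG t 0 \<le> 1 + ?c" .
  qed (use \<eta> \<delta> rep in \<open>auto simp: wG_def edist_commute intro!: add_nonneg_nonneg sum_nonneg\<close>)
  also have "\<dots> \<le> n / (1024 * s) + n / (1024 * s) + n / (1024 * s)"
  proof (intro add_mono)
    show "real n * \<eta> \<le> n / (1024 * s)" by (simp add: \<eta>_def)
    have Nk': "real N * real k \<le> 2 * n" using clusters_le by (simp flip: of_nat_mult)
    have n': "8192 * real k * (3 * 2 ^ B) ^ d \<le> n"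
    proof -
      have "real (8192 * (k * (3 * 2 ^ B) ^ d)) \<le> real n" using cells_le by (simp only: of_nat_le_iff)
      then show ?thesis by (simp add: mult.assoc)
    qed
    have "real (card {i. i < N \<and> rep i = i}) \<le> 12 * N / 200000 + (3 * 2 ^ B) ^ d"
    proof -
      have "real (card {i. i < N \<and> rep i = i}) \<le>
          real (card {i. i < N \<and> (\<Sum>l<d. (center A i l)\<^sup>2) > 200000} + (3 * 2 ^ B) ^ d)"
        using card_rep by (simp only: of_nat_le_iff)
      then show ?thesis using outliers by simp
    qed
    then have "real (card {i. i < N \<and> rep i = i}) * real k \<le> (12 * N / 200000 + (3 * 2 ^ B) ^ d) * real k"
      by (intro mult_right_mono) auto
    also have "\<dots> = 12 / 200000 * (real N * real k) + (8192 * real k * (3 * 2 ^ B) ^ d) / 8192"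
      by (simp add: algebra_simps)
    \<comment> \<open>Outliers and occupied cells each take about half of the budget
      \<open>n / 4096\<close>.\<close>
    also have "\<dots> \<le> 12 / 200000 * (2 * n) + n / 8192"
      using Nk' n' by (intro add_mono mult_left_mono divide_right_mono) auto
    also have "\<dots> \<le> n / 4096" by simp
    finally have "real (card {i. i < N \<and> rep i = i}) * real k * (4 * \<delta>) \<le> n / 4096 * (4 * \<delta>)"
      using \<delta> by (intro mult_right_mono) auto
    then show "real (card {i. i < N \<and> rep i = i}) * real k * (4 * \<delta>) \<le> n / (1024 * s)"
      by (simp add: \<delta>_def)
    have "(\<Sum>i<N. 1 + (\<Sum>l<d. (center A i l)\<^sup>2)) \<le> 13 * N"
      using sum_center by (simp add: sum.distrib)
    also have "\<dots> \<le> 26 * n / k" using Nk' k by (simp add: field_simps)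
    also have "\<dots> = n / s * (26 / s)" by (simp add: k_def power2_eq_square)
    \<comment> \<open>The threshold \<open>26624 = 26 * 1024\<close> for \<open>s\<close> comes from
      this step.\<close>
    also have "\<dots> \<le> n / s * (1 / 1024)"
      using s by (intro mult_left_mono) (auto simp: field_simps)
    finally show "(\<Sum>i<N. 1 + (\<Sum>l<d. (center A i l)\<^sup>2)) \<le> n / (1024 * s)" by simp
  qed
  finally show ?thesis by simp
qed

text \<open>An arc inside a cluster has projected length at least \<open>\<delta> / 32\<close>, so
  the bound on the projected cost allows at most \<open>3 * n / 16\<close> of them among at least
  \<open>2 * (n - 1)\<close> arcs. The remaining arcs join different clusters and have original
  length at least 1.\<close>

lemma pulled_back_cost_bound:
  assumes S: "spanning_tree {..<n} S"
    and minimal: "\<And>S'. spanning_tree {..<n} S' \<Longrightarrow> wcost wG S \<le> wcost wG S'"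
  shows "n / 2 \<le> wcost (\<lambda>u v. edist n (x u) (x v)) S"
proof -
  let ?U = "L2_set (\<lambda>l. A (l, 0)) {..<d}"
  define C where "C = {(u, v) \<in> arcs_of S. u div k \<noteq> v div k}"
  define I where "I = {(u, v) \<in> arcs_of S. u div k = v div k}"
  have fin: "finite (arcs_of S)" using S by (rule finite_arcs_of) simp
  have finCI: "finite C" "finite I" by (auto intro!: finite_subset[OF _ fin] simp: C_def I_def)
  have un: "arcs_of S = C \<union> I" "C \<inter> I = {}" by (auto simp: C_def I_def)
  have arcs: "real (card C) + real (card I) \<ge> 2 * (real n - 1)"
  proof -
    have "2 * (n - 1) \<le> card C + card I"
      using card_arcs_spanning_tree[OF S] un finCI by (simp add: card_Un_disjoint)
    then have "real (2 * (n - 1)) \<le> real (card C + card I)" by (simp only: of_nat_le_iff)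
    then show ?thesis using n_ge by simp
  qed
  have "card I * (\<delta> / 32) = (\<Sum>(u, v)\<in>I. \<delta> / 32)" by simp
  also have "\<dots> \<le> (\<Sum>(u, v)\<in>I. wG u v)"
  proof (rule sum_mono, clarify)
    fix u v assume uv: "(u, v) \<in> I"
    then have arc: "(u, v) \<in> arcs_of S" and div: "u div k = v div k" by (auto simp: I_def)
    have "u < n" "v < n" "u \<noteq> v" using spanning_tree_arc[OF S arc] by auto
    have "u mod k \<noteq> v mod k" using \<open>u \<noteq> v\<close> div by (metis div_mult_mod_eq)
    then have "1 \<le> \<bar>real (u mod k) - real (v mod k)\<bar>" by linarith
    then have "\<delta> * 1 * (1 / 32) \<le> \<delta> * \<bar>real (u mod k) - real (v mod k)\<bar> * ?U"
      using \<delta> column_norm_bounds(1) by (intro mult_mono) auto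
    also have "\<dots> = wG u v"
      using edist_lin_map_same_cluster[of u n v k d A \<delta>] \<open>u < n\<close> \<open>v < n\<close> div \<delta>
      by (simp add: wG_def x_def k_def abs_mult)
    finally show "\<delta> / 32 \<le> wG u v" by simp
  qed
  also have "\<dots> \<le> (\<Sum>(u, v)\<in>arcs_of S. wG u v)"
    using fin un by (intro sum_mono2) (auto simp: wG_def edist_def)
  also have "\<dots> = 2 * wcost wG S" by (simp add: wcost_def)
  also have "\<dots> \<le> 2 * (3 * n / (1024 * s))"
    using minimal_tree_cost_bound[OF S minimal] by simp
  finally have "card I * (\<delta> / 32) \<le> 2 * (3 * n / (1024 * s))" .
  then have cI: "card I \<le> 3 / 16 * real n" using s by (simp add: \<delta>_def field_simps)
  have "real (card C) = (\<Sum>(u, v)\<in>C. 1)" by simp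
  also have "\<dots> \<le> (\<Sum>(u, v)\<in>C. edist n (x u) (x v))"
  proof (rule sum_mono, clarify)
    fix u v assume uv: "(u, v) \<in> C"
    then have arc: "(u, v) \<in> arcs_of S" and div: "u div k \<noteq> v div k" by (auto simp: C_def)
    show "1 \<le> edist n (x u) (x v)"
      unfolding x_def
      using spanning_tree_arc[OF S arc] div by (intro edist_cluster_point_cross) auto
  qed
  also have "\<dots> \<le> (\<Sum>(u, v)\<in>arcs_of S. edist n (x u) (x v))"
    using fin un by (intro sum_mono2) (auto simp: edist_def)
  also have "\<dots> = 2 * wcost (\<lambda>u v. edist n (x u) (x v)) S" by (simp add: wcost_def)
  finally show ?thesis using arcs cI n_ge by simp
qed

end

section \<open>Gaussian matrices\<close>

definition gaussian_entry :: "nat \<Rightarrow> real measure" where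
  "gaussian_entry d = density lborel (normal_density 0 (sqrt (1 / real d)))"

lemma gaussian_matrix_eq:
  "gaussian_matrix d m = (\<Pi>\<^sub>M ij\<in>{..<d} \<times> {..<m}. gaussian_entry d)"
  by (simp add: gaussian_matrix_def gaussian_entry_def)

lemma sets_gaussian_entry [simp, measurable_cong]: "sets (gaussian_entry d) = sets borel"
  by (simp add: gaussian_entry_def)

lemma prob_space_gaussian_entry: "d \<ge> 1 \<Longrightarrow> prob_space (gaussian_entry d)"
  unfolding gaussian_entry_def by (rule prob_space_normal_density) simp

lemma prob_space_gaussian_matrix: "d \<ge> 1 \<Longrightarrow> prob_space (gaussian_matrix d m)"
  unfolding gaussian_matrix_eq by (intro prob_space_PiM prob_space_gaussian_entry)

lemma product_prob_space_gaussian: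
  "d \<ge> 1 \<Longrightarrow> product_prob_space (\<lambda>_. gaussian_entry d)"
  by (intro product_prob_spaceI prob_space_gaussian_entry)

lemma measurable_entry [measurable]:
  "l < d \<Longrightarrow> i < m \<Longrightarrow> (\<lambda>A. A (l, i)) \<in> borel_measurable (gaussian_matrix d m)"
  unfolding gaussian_matrix_eq
  by (rule measurable_cong_sets[THEN equalityD1, THEN subsetD, OF refl sets_gaussian_entry])
     (rule measurable_component_singleton, simp)

lemma nn_integral_gaussian_entry:
  "f \<in> borel_measurable borel \<Longrightarrow> (\<integral>\<^sup>+x. f x \<partial>gaussian_entry d) =
     (\<integral>\<^sup>+x. ennreal (normal_density 0 (sqrt (1 / real d)) x) * f x \<partial>lborel)"
  unfolding gaussian_entry_def by (rule nn_integral_density) auto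

lemma gaussian_entry_square:
  assumes "d \<ge> 1"
  shows "(\<integral>\<^sup>+x. ennreal (x\<^sup>2) \<partial>gaussian_entry d) = ennreal (1 / d)"
proof -
  define \<sigma> where "\<sigma> = sqrt (1 / real d)"
  have \<sigma>: "\<sigma> > 0" using assms by (simp add: \<sigma>_def)
  have h: "has_bochner_integral lborel (\<lambda>x. normal_density 0 \<sigma> x * x\<^sup>2) (1 / d)"
    using normal_moment_even[OF \<sigma>, of 0 1] assms by (simp add: \<sigma>_def)
  have "(\<integral>\<^sup>+x. ennreal (x\<^sup>2) \<partial>gaussian_entry d) = (\<integral>\<^sup>+x. ennreal (normal_density 0 \<sigma> x * x\<^sup>2) \<partial>lborel)"
    by (simp add: nn_integral_gaussian_entry ennreal_mult \<sigma>_def)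
  also have "\<dots> = ennreal (1 / d)"
    using h by (subst nn_integral_eq_integral) (auto simp: has_bochner_integral_iff)
  finally show ?thesis .
qed

text \<open>The exponential factor turns the density into a multiple of the normal density of
  variance \<open>1 / (d * (1 + 2 * t))\<close>, and the multiple is the integral.\<close>

lemma gaussian_entry_exp:
  fixes t :: real
  assumes d: "d \<ge> 1" and t: "t \<ge> 0"
  shows "(\<integral>\<^sup>+x. ennreal (exp (- (t * real d) * x\<^sup>2)) \<partial>gaussian_entry d) = ennreal (1 / sqrt (1 + 2 * t))"
proof -
  define \<sigma> where "\<sigma> = sqrt (1 / real d)"
  define \<sigma>' where "\<sigma>' = sqrt (1 / (real d * (1 + 2 * t)))"
  have \<sigma>': "\<sigma>' > 0" using assms by (simp add: \<sigma>'_def)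
  have eq: "normal_density 0 \<sigma> x * exp (- (t * real d) * x\<^sup>2) = 1 / sqrt (1 + 2 * t) * normal_density 0 \<sigma>' x" for x
  proof -
    have e: "exp (- (x\<^sup>2 * d / 2)) * exp (- (t * d * x\<^sup>2)) = exp (- (x\<^sup>2 * (d * (1 + 2 * t)) / 2))"
      by (simp add: exp_add [symmetric] algebra_simps)
    have s: "sqrt (2 * pi / d) = sqrt (1 + 2 * t) * sqrt (2 * pi / (d * (1 + 2 * t)))"
      using assms by (simp flip: real_sqrt_mult)
    show ?thesis
      using assms e s by (simp add: normal_density_def \<sigma>_def \<sigma>'_def)
  qed
  have "(\<integral>\<^sup>+x. ennreal (exp (- (t * real d) * x\<^sup>2)) \<partial>gaussian_entry d) =
      (\<integral>\<^sup>+x. ennreal (normal_density 0 \<sigma> x * exp (- (t * real d) * x\<^sup>2)) \<partial>lborel)"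
    by (simp add: nn_integral_gaussian_entry ennreal_mult \<sigma>_def)
  also have "\<dots> = (\<integral>\<^sup>+x. ennreal (1 / sqrt (1 + 2 * t)) * ennreal (normal_density 0 \<sigma>' x) \<partial>lborel)"
    unfolding eq using t by (intro nn_integral_cong ennreal_mult) auto
  also have "\<dots> = ennreal (1 / sqrt (1 + 2 * t)) * (\<integral>\<^sup>+x. ennreal (normal_density 0 \<sigma>' x) \<partial>lborel)"
    by (rule nn_integral_cmult) auto
  also have "(\<integral>\<^sup>+x. ennreal (normal_density 0 \<sigma>' x) \<partial>lborel) = 1"
    using \<sigma>' by (simp add: nn_integral_eq_integral)
  finally show ?thesis by simp
qed

section \<open>Column norms of a Gaussian matrix\<close>

lemma nn_integral_gaussian_component:
  assumes "d \<ge> 1" "l < d" "i < m" and [measurable]: "f \<in> borel_measurable borel"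
  shows "(\<integral>\<^sup>+A. f (A (l, i)) \<partial>gaussian_matrix d m) = (\<integral>\<^sup>+x. f x \<partial>gaussian_entry d)"
proof -
  interpret product_prob_space "\<lambda>_. gaussian_entry d" "{..<d} \<times> {..<m}"
    using product_prob_space_gaussian[OF assms(1)] .
  have "distr (gaussian_matrix d m) (gaussian_entry d) (\<lambda>A. A (l, i)) = gaussian_entry d"
    unfolding gaussian_matrix_eq using assms by (intro PiM_component) auto
  then have "(\<integral>\<^sup>+x. f x \<partial>gaussian_entry d) =
      (\<integral>\<^sup>+x. f x \<partial>distr (gaussian_matrix d m) (gaussian_entry d) (\<lambda>A. A (l, i)))"
    by simp
  also have "\<dots> = (\<integral>\<^sup>+A. f (A (l, i)) \<partial>gaussian_matrix d m)"
  proof (rule nn_integral_distr)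
    show "(\<lambda>A. A (l, i)) \<in> measurable (gaussian_matrix d m) (gaussian_entry d)"
      using measurable_entry[OF assms(2,3)]
      by (simp add: measurable_cong_sets[OF refl sets_gaussian_entry])
    show "f \<in> borel_measurable (distr (gaussian_matrix d m) (gaussian_entry d) (\<lambda>A. A (l, i)))"
      using assms(4) by (simp add: measurable_cong_sets[OF sets_gaussian_entry refl])
  qed
  finally show ?thesis ..
qed

text \<open>A column has expected squared norm 1, so the sum has expectation \<open>card I\<close>
  and Markov's inequality applies. The cases of interest are column 0 alone and the columns of all
  cluster centres.\<close>

lemma prob_columns_large:
  assumes d: "d \<ge> 1" and I: "I \<subseteq> {..<m}" "I \<noteq> {}"
  shows "measure (gaussian_matrix d m)
    {A \<in> space (gaussian_matrix d m). (\<Sum>i\<in>I. \<Sum>l<d. (A (l, i))\<^sup>2) \<ge> 12 * real (card I)} \<le> 1 / 12"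
    (is "measure ?M {A \<in> space ?M. ?u A \<ge> ?c} \<le> _")
proof -
  interpret prob_space ?M by (rule prob_space_gaussian_matrix[OF d])
  have fin: "finite I" using I(1) finite_subset by blast
  then have c: "card I > 0" using I by (simp add: card_gt_0_iff)
  have m: "(\<lambda>A. A (l, i)) \<in> borel_measurable ?M" if "l < d" "i \<in> I" for l i
    using that I by (intro measurable_entry) auto
  have mu [measurable]: "?u \<in> borel_measurable ?M"
    by (intro borel_measurable_sum borel_measurable_power m) auto
  have "(\<integral>\<^sup>+A. ennreal (?u A) \<partial>?M) = (\<integral>\<^sup>+A. (\<Sum>i\<in>I. \<Sum>l<d. ennreal ((A (l, i))\<^sup>2)) \<partial>?M)"
    by (simp add: sum_nonneg)
  also have "\<dots> = (\<Sum>i\<in>I. \<Sum>l<d. (\<integral>\<^sup>+A. ennreal ((A (l, i))\<^sup>2) \<partial>?M))"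
  proof -
    have m2: "(\<lambda>A. ennreal ((A (l, i))\<^sup>2)) \<in> borel_measurable ?M" if "l < d" "i \<in> I" for l i
      using m[OF that] by measurable
    have "(\<integral>\<^sup>+A. (\<Sum>i\<in>I. \<Sum>l<d. ennreal ((A (l, i))\<^sup>2)) \<partial>?M) =
        (\<Sum>i\<in>I. (\<integral>\<^sup>+A. (\<Sum>l<d. ennreal ((A (l, i))\<^sup>2)) \<partial>?M))"
      by (intro nn_integral_sum borel_measurable_sum m2) auto
    also have "\<dots> = (\<Sum>i\<in>I. \<Sum>l<d. (\<integral>\<^sup>+A. ennreal ((A (l, i))\<^sup>2) \<partial>?M))"
      by (intro sum.cong refl nn_integral_sum m2) auto
    finally show ?thesis .
  qed
  also have "\<dots> = (\<Sum>i\<in>I. \<Sum>l<d. ennreal (1 / d))"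
    using I d by (intro sum.cong refl)
      (auto simp: nn_integral_gaussian_component[where f = "\<lambda>x. ennreal (x\<^sup>2)"] gaussian_entry_square)
  also have "\<dots> = ennreal (\<Sum>i\<in>I. \<Sum>l<d. 1 / d)"
    by (simp add: sum_nonneg del: sum_constant)
  also have "(\<Sum>i\<in>I. \<Sum>l<d. 1 / d) = card I" using d by simp
  finally have int: "(\<integral>\<^sup>+A. ennreal (?u A) \<partial>?M) = ennreal (card I)" .
  have "{A \<in> space ?M. ?u A \<ge> ?c} = {A \<in> space ?M. 1 \<le> ennreal (1 / ?c) * ennreal (?u A)}"
    using c by (auto simp: sum_nonneg field_simps simp flip: ennreal_mult ennreal_1)
  also have "emeasure ?M \<dots> \<le> ennreal (1 / ?c) * (\<integral>\<^sup>+A. ennreal (?u A) * indicator (space ?M) A \<partial>?M)"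
    by (rule nn_integral_Markov_inequality) measurable
  also have "(\<integral>\<^sup>+A. ennreal (?u A) * indicator (space ?M) A \<partial>?M) = ennreal (card I)"
    unfolding int [symmetric] by (intro nn_integral_cong) simp
  also have "ennreal (1 / ?c) * ennreal (card I) = ennreal (1 / 12)"
    using c by (simp flip: ennreal_mult)
  finally show ?thesis by (simp add: emeasure_eq_measure)
qed

text \<open>
  Markov's inequality for \<open>exp (- 1024 d |G e\<^sub>i|\<^sup>2)\<close> gives the bound \<open>(e / sqrt 2049) ^ d\<close>,
  which is at most \<open>1/12\<close> uniformly in \<open>d\<close>.
\<close>

lemma prob_column_small:
  assumes d: "d \<ge> 1" and i: "i < m"
  shows "measure (gaussian_matrix d m)
    {A \<in> space (gaussian_matrix d m). (\<Sum>l<d. (A (l, i))\<^sup>2) \<le> (1 / 32)\<^sup>2} \<le> 1 / 12"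
    (is "measure ?M {A \<in> space ?M. ?u A \<le> ?c} \<le> _")
proof -
  interpret Q: prob_space ?M by (rule prob_space_gaussian_matrix[OF d])
  interpret product_prob_space "\<lambda>_. gaussian_entry d" "{..<d} \<times> {..<m}"
    using product_prob_space_gaussian[OF d] .
  have m: "(\<lambda>A. A (l, i)) \<in> borel_measurable ?M" if "l < d" for l
    using that i by (intro measurable_entry) auto
  have mu [measurable]: "?u \<in> borel_measurable ?M"
    by (intro borel_measurable_sum borel_measurable_power m) auto
  \<comment> \<open>The value of \<open>gaussian_entry_exp\<close> at
    \<open>t = 1024\<close>.\<close>
  define q where "q = 1 / sqrt 2049"
  have q: "0 \<le> q" "q \<le> 1" by (auto simp: q_def real_le_rsqrt)
  \<comment> \<open>The factor is 1 outside column \<open>i\<close>, which writes the exponential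
    for one column as a product over all entries, so that independence applies.\<close>
  define g where "g ij = (\<lambda>x. if snd ij = i then ennreal (exp (- (1024 * real d) * x\<^sup>2)) else 1)" for ij :: "nat \<times> nat"
  have prod_i: "(\<Prod>ij\<in>{..<d} \<times> {..<m}. if snd ij = i then h (fst ij) else 1) = (\<Prod>l<d. h l)"
    for h :: "nat \<Rightarrow> ennreal"
  proof -
    have "(\<Prod>ij\<in>{..<d} \<times> {..<m}. if snd ij = i then h (fst ij) else 1) =
        (\<Prod>l<d. \<Prod>j<m. if j = i then h l else 1)"
      unfolding prod.cartesian_product by (intro prod.cong) auto
    also have "\<dots> = (\<Prod>l<d. h l)" using i by simp
    finally show ?thesis .
  qed
  have "(\<integral>\<^sup>+A. ennreal (exp (- (1024 * real d) * ?u A)) \<partial>?M) =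
      (\<integral>\<^sup>+A. (\<Prod>ij\<in>{..<d} \<times> {..<m}. g ij (A ij)) \<partial>?M)"
  proof (intro nn_integral_cong)
    fix A :: "nat \<times> nat \<Rightarrow> real"
    have "(\<Prod>ij\<in>{..<d} \<times> {..<m}. g ij (A ij)) =
        (\<Prod>ij\<in>{..<d} \<times> {..<m}. if snd ij = i then ennreal (exp (- (1024 * real d) * (A (fst ij, i))\<^sup>2)) else 1)"
      by (intro prod.cong) (auto simp: g_def)
    also have "\<dots> = (\<Prod>l<d. ennreal (exp (- (1024 * real d) * (A (l, i))\<^sup>2)))" by (rule prod_i)
    also have "\<dots> = ennreal (\<Prod>l<d. exp (- (1024 * real d) * (A (l, i))\<^sup>2))" by (rule prod_ennreal) simp
    also have "\<dots> = ennreal (exp (- (1024 * real d) * ?u A))"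
      by (simp add: exp_sum [symmetric] sum_distrib_left)
    finally show "ennreal (exp (- (1024 * real d) * ?u A)) = (\<Prod>ij\<in>{..<d} \<times> {..<m}. g ij (A ij))" ..
  qed
  also have "\<dots> = (\<Prod>ij\<in>{..<d} \<times> {..<m}. integral\<^sup>N (gaussian_entry d) (g ij))"
    unfolding gaussian_matrix_eq
    by (rule product_nn_integral_prod)
       (auto simp: g_def measurable_cong_sets[OF sets_gaussian_entry refl])
  also have "\<dots> = (\<Prod>ij\<in>{..<d} \<times> {..<m}. if snd ij = i then ennreal q else 1)"
    using gaussian_entry_exp[OF d, of 1024] prob_space.emeasure_space_1[OF prob_space_gaussian_entry[OF d]]
    by (intro prod.cong refl) (auto simp: g_def q_def)
  also have "\<dots> = (\<Prod>l<d. ennreal q)" by (rule prod_i)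
  also have "\<dots> = ennreal (q ^ d)" using q by (simp add: ennreal_power)
  finally have int: "(\<integral>\<^sup>+A. ennreal (exp (- (1024 * real d) * ?u A)) \<partial>?M) = ennreal (q ^ d)" .
  \<comment> \<open>On this event the exponent is at least \<open>- d\<close>, as
    \<open>1024 * (1 / 32)\<^sup>2 = 1\<close>.\<close>
  have "{A \<in> space ?M. ?u A \<le> ?c} \<subseteq>
      {A \<in> space ?M. 1 \<le> ennreal (exp d) * ennreal (exp (- (1024 * real d) * ?u A))}"
  proof -
    have "1 \<le> exp (real d) * exp (- (1024 * real d) * ?u A)" if "?u A \<le> ?c" for A
    proof -
      have "?u A \<le> 1 / 1024" using that by (simp add: power2_eq_square)
      then have "d * (1024 * ?u A) \<le> real d * 1" by (intro mult_left_mono) auto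
      then show ?thesis by (simp add: exp_add [symmetric] algebra_simps)
    qed
    then show ?thesis by (auto simp flip: ennreal_mult ennreal_1 intro!: ennreal_leI)
  qed
  then have "emeasure ?M {A \<in> space ?M. ?u A \<le> ?c} \<le>
      emeasure ?M {A \<in> space ?M. 1 \<le> ennreal (exp d) * ennreal (exp (- (1024 * real d) * ?u A))}"
    by (rule emeasure_mono) measurable
  also have "\<dots> \<le> ennreal (exp d) *
      (\<integral>\<^sup>+A. ennreal (exp (- (1024 * real d) * ?u A)) * indicator (space ?M) A \<partial>?M)"
    by (rule nn_integral_Markov_inequality) measurable
  also have "(\<integral>\<^sup>+A. ennreal (exp (- (1024 * real d) * ?u A)) * indicator (space ?M) A \<partial>?M) = ennreal (q ^ d)"
    unfolding int [symmetric] by (intro nn_integral_cong) simp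
  also have "ennreal (exp d) * ennreal (q ^ d) = ennreal ((exp 1 * q) ^ d)"
    using q by (simp add: ennreal_mult [symmetric] power_mult_distrib exp_of_nat_mult [symmetric])
  also have "\<dots> \<le> ennreal (1 / 12)"
  proof (rule ennreal_leI)
    have "(36 :: real) \<le> sqrt 2049" by (rule real_le_rsqrt) simp
    moreover have "exp (1 :: real) \<le> 3" by (rule exp_le)
    ultimately have "12 * exp 1 \<le> sqrt 2049" by simp
    then have e: "exp 1 * q \<le> 1 / 12" by (simp add: q_def field_simps)
    moreover have "(exp 1 * q) ^ d \<le> (exp 1 * q) ^ 1"
      using d e q by (intro power_decreasing) auto
    ultimately show "(exp 1 * q) ^ d \<le> 1 / 12" by simp
  qed
  finally show ?thesis by (simp add: Q.emeasure_eq_measure)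
qed

text \<open>With all other entries fixed, the sum is a non-constant affine function of the entry
  \<open>(0, q)\<close>, which has a density and so avoids the single root almost surely. Fubini's
  theorem does the rest.\<close>

lemma AE_row_nonzero:
  assumes d: "d \<ge> 1" and q: "q < m" "v q \<noteq> 0"
  shows "AE A in gaussian_matrix d m. (\<Sum>j<m. A (0, j) * v j) \<noteq> 0"
proof -
  interpret product_prob_space "\<lambda>_. gaussian_entry d" "{..<d} \<times> {..<m}"
    using product_prob_space_gaussian[OF d] .
  define I where "I = {..<d} \<times> {..<m} - {(0, q)}"
  have I: "finite I" "(0, q) \<notin> I" "insert (0, q) I = {..<d} \<times> {..<m}"
    using d q by (auto simp: I_def)
  define S where "S A = (\<Sum>j<m. A (0, j) * v j)" for A :: "nat \<times> nat \<Rightarrow> real"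
  have S [measurable]: "S \<in> borel_measurable (gaussian_matrix d m)"
    unfolding S_def using d by (intro borel_measurable_sum borel_measurable_times measurable_entry) auto
  have "(\<integral>\<^sup>+A. indicator {0} (S A) \<partial>gaussian_matrix d m) =
      (\<integral>\<^sup>+A. indicator {0} (S A) \<partial>Pi\<^sub>M (insert (0, q) I) (\<lambda>_. gaussian_entry d))"
    by (simp add: gaussian_matrix_eq I)
  also have "\<dots> = (\<integral>\<^sup>+A. (\<integral>\<^sup>+y. indicator {0} (S (A((0, q) := y))) \<partial>gaussian_entry d)
      \<partial>Pi\<^sub>M I (\<lambda>_. gaussian_entry d))"
    using I S by (intro product_nn_integral_insert) (auto simp: gaussian_matrix_eq intro: measurable_compose)
  also have "\<dots> = (\<integral>\<^sup>+A. 0 \<partial>Pi\<^sub>M I (\<lambda>_. gaussian_entry d))"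
  proof (intro nn_integral_cong)
    fix A :: "nat \<times> nat \<Rightarrow> real"
    define c where "c = (\<Sum>j\<in>{..<m} - {q}. A (0, j) * v j)"
    have SA: "S (A((0, q) := y)) = y * v q + c" for y
      unfolding S_def c_def using q by (subst sum.remove[of _ q]) (auto intro!: sum.cong)
    have "AE y in lborel. y \<noteq> - c / v q" by (rule AE_lborel_singleton)
    then have "AE y in gaussian_entry d. y \<noteq> - c / v q"
      unfolding gaussian_entry_def by (subst AE_density) auto
    then have "AE y in gaussian_entry d. (indicator {0} (S (A((0, q) := y))) :: ennreal) = 0"
      by eventually_elim (use q in \<open>auto simp: SA indicator_def field_simps\<close>)
    then show "(\<integral>\<^sup>+y. indicator {0} (S (A((0, q) := y))) \<partial>gaussian_entry d) = 0"
      by (subst nn_integral_cong_AE[of _ "\<lambda>_. 0"]) auto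
  qed
  finally have "AE A in gaussian_matrix d m. (indicator {0} (S A) :: ennreal) = 0"
    by (subst nn_integral_0_iff_AE [symmetric]) auto
  then show ?thesis by eventually_elim (auto simp: S_def indicator_def split: if_splits)
qed

text \<open>Injectivity belongs to the event because \<open>pull_back\<close> is meaningful only
  then. The bound is asked of every minimum spanning tree, so ties need no selection rule.\<close>

definition good_event :: "nat \<Rightarrow> nat \<Rightarrow> (nat \<Rightarrow> real) set \<Rightarrow> real \<Rightarrow> (nat \<times> nat \<Rightarrow> real) \<Rightarrow> bool" where
  "good_event d m X C A \<longleftrightarrow> inj_on (lin_map d m A) X \<and>
    (\<forall>T. is_mst d (lin_map d m A ` X) T \<longrightarrow> C \<le> tree_cost m (pull_back (lin_map d m A) X T))"

text \<open>The event becomes a statement about trees on the index set, in which the matrix enters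
  only through injectivity and edge costs.\<close>

lemma good_event_iff:
  fixes A :: "nat \<times> nat \<Rightarrow> real" and x :: "'a \<Rightarrow> nat \<Rightarrow> real" and d m :: nat
  assumes inj: "inj_on x Y"
  defines "c \<equiv> wcost (\<lambda>u v. edist d (lin_map d m A (x u)) (lin_map d m A (x v)))"
  shows "good_event d m (x ` Y) C A \<longleftrightarrow> inj_on (\<lambda>t. lin_map d m A (x t)) Y \<and>
    (\<forall>S\<in>{S. spanning_tree Y S}. (\<forall>S'\<in>{S. spanning_tree Y S}. c S \<le> c S') \<longrightarrow>
      C \<le> wcost (\<lambda>u v. edist m (x u) (x v)) S)"
proof -
  let ?L = "lin_map d m A"
  let ?g = "\<lambda>t. ?L (x t)"
  have inj_iff: "inj_on ?L (x ` Y) \<longleftrightarrow> inj_on ?g Y"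
    using comp_inj_on_iff[OF inj, of ?L] by (simp add: o_def)
  have "(\<forall>T. is_mst d (?L ` x ` Y) T \<longrightarrow> C \<le> tree_cost m (pull_back ?L (x ` Y) T)) \<longleftrightarrow>
    (\<forall>S\<in>{S. spanning_tree Y S}. (\<forall>S'\<in>{S. spanning_tree Y S}. c S \<le> c S') \<longrightarrow>
      C \<le> wcost (\<lambda>u v. edist m (x u) (x v)) S)" (is "?l \<longleftrightarrow> ?r") if g: "inj_on ?g Y"
  proof -
    have mst: "is_mst d (?L ` x ` Y) T \<longleftrightarrow> (\<exists>S. spanning_tree Y S \<and> T = (`) ?g ` S \<and>
        (\<forall>S'. spanning_tree Y S' \<longrightarrow> c S \<le> c S'))" for T
      using is_mst_image[OF g, of d T] by (simp only: image_image c_def)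
    have cost: "tree_cost m (pull_back ?L (x ` Y) ((`) ?g ` S)) = wcost (\<lambda>u v. edist m (x u) (x v)) S"
      if S: "spanning_tree Y S" for S
    proof -
      have "(`) ?g ` S = (`) ?L ` ((`) x ` S)" by (simp add: image_image)
      then have "pull_back ?L (x ` Y) ((`) ?g ` S) = (`) x ` S"
        using pull_back_image[OF spanning_tree_image[OF S inj]] g inj_iff by metis
      then show ?thesis by (simp add: tree_cost_eq_wcost wcost_image[OF S inj])
    qed
    show ?thesis
    proof
      assume l: ?l
      show ?r
      proof (intro ballI impI)
        fix S assume S: "S \<in> {S. spanning_tree Y S}" "\<forall>S'\<in>{S. spanning_tree Y S}. c S \<le> c S'"
        then have "is_mst d (?L ` x ` Y) ((`) ?g ` S)" unfolding mst by blast
        then have "C \<le> tree_cost m (pull_back ?L (x ` Y) ((`) ?g ` S))" using l by blast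
        then show "C \<le> wcost (\<lambda>u v. edist m (x u) (x v)) S" using S(1) cost by simp
      qed
    next
      assume r: ?r
      show ?l
      proof (intro allI impI)
        fix T assume "is_mst d (?L ` x ` Y) T"
        then obtain S where S: "spanning_tree Y S" "T = (`) ?g ` S"
          "\<forall>S'\<in>{S. spanning_tree Y S}. c S \<le> c S'" unfolding mst by blast
        then have "C \<le> wcost (\<lambda>u v. edist m (x u) (x v)) S" using r by blast
        then show "C \<le> tree_cost m (pull_back ?L (x ` Y) T)" unfolding S(2) cost[OF S(1)] .
      qed
    qed
  qed
  then show ?thesis unfolding good_event_def inj_iff by blast
qed

lemma measurable_edist_lin_map:
  "(\<lambda>A. edist d (lin_map d m A u) (lin_map d m A v)) \<in> borel_measurable (gaussian_matrix d m)"
proof -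
  have "(\<lambda>A. lin_map d m A u l) \<in> borel_measurable (gaussian_matrix d m)" if "l < d" for u l
    using that by (auto simp: lin_map_def intro!: borel_measurable_sum borel_measurable_times measurable_entry)
  then show ?thesis
    unfolding edist_def L2_set_def
    by (intro measurable_compose[OF _ borel_measurable_sqrt] borel_measurable_sum
        borel_measurable_power borel_measurable_diff) auto
qed

text \<open>Both images vanish from index \<open>d\<close> on, so distance 0 forces equality as
  functions.\<close>

lemma lin_map_eq_iff: "lin_map d m A u = lin_map d m A v \<longleftrightarrow> edist d (lin_map d m A u) (lin_map d m A v) = 0"
  by (auto simp: edist_def L2_set_eq_0_iff) (auto simp: lin_map_def fun_eq_iff)

text \<open>With injectivity read as nonvanishing of distances, the event is a finite Boolean
  combination of comparisons between measurable costs.\<close>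

lemma sets_good_event:
  assumes inj: "inj_on x Y" and Y: "finite Y"
  shows "{A \<in> space (gaussian_matrix d m). good_event d m (x ` Y) C A} \<in> sets (gaussian_matrix d m)"
proof -
  let ?M = "gaussian_matrix d m"
  let ?F = "{S. spanning_tree Y S}"
  define c where "c S A = wcost (\<lambda>u v. edist d (lin_map d m A (x u)) (lin_map d m A (x v))) S" for S A
  have [measurable]: "c S \<in> borel_measurable ?M" for S
    unfolding c_def wcost_def case_prod_unfold
    by (intro borel_measurable_divide borel_measurable_sum measurable_edist_lin_map) auto
  have F: "finite ?F" using Y by (rule finite_spanning_trees)
  have [measurable]: "(\<lambda>A. edist d (lin_map d m A u) (lin_map d m A v)) \<in> borel_measurable ?M" for u v
    by (rule measurable_edist_lin_map)
  have inj_iff: "inj_on (\<lambda>t. lin_map d m A (x t)) Y \<longleftrightarrow>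
      (\<forall>t\<in>Y. \<forall>t'\<in>Y. \<not> (t \<noteq> t' \<and> edist d (lin_map d m A (x t)) (lin_map d m A (x t')) = 0))" for A
    unfolding inj_on_def lin_map_eq_iff by blast
  have "{A \<in> space ?M. \<not> (t \<noteq> t' \<and> edist d (lin_map d m A (x t)) (lin_map d m A (x t')) = 0)} \<in> sets ?M"
    for t t' by measurable
  then have 1: "{A \<in> space ?M. inj_on (\<lambda>t. lin_map d m A (x t)) Y} \<in> sets ?M"
    unfolding inj_iff using Y by (intro sets.sets_Collect_finite_All) auto
  have "{A \<in> space ?M. c S A \<le> c S' A} \<in> sets ?M" for S S' by measurable
  then have "{A \<in> space ?M. \<forall>S'\<in>?F. c S A \<le> c S' A} \<in> sets ?M" for S
    using F by (intro sets.sets_Collect_finite_All)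
  then have "{A \<in> space ?M. (\<forall>S'\<in>?F. c S A \<le> c S' A) \<longrightarrow>
      C \<le> wcost (\<lambda>u v. edist m (x u) (x v)) S} \<in> sets ?M" for S
    by (rule sets.sets_Collect_imp[OF sets.sets_Collect_const])
  then have 2: "{A \<in> space ?M. \<forall>S\<in>?F. (\<forall>S'\<in>?F. c S A \<le> c S' A) \<longrightarrow>
      C \<le> wcost (\<lambda>u v. edist m (x u) (x v)) S} \<in> sets ?M"
    using F by (intro sets.sets_Collect_finite_All)
  show ?thesis
    unfolding good_event_iff[OF inj] using sets.sets_Collect_conj[OF 2 1] unfolding c_def .
qed

text \<open>Two distinct points differ in a coordinate below \<open>n\<close>, so row 0 of the
  matrix already separates their images almost surely, and there are finitely many pairs.\<close>

lemma AE_inj_on_lin_map: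
  assumes d: "d \<ge> 1" and \<delta>: "\<delta> > 0"
  shows "AE A in gaussian_matrix d n. inj_on (\<lambda>t. lin_map d n A (cluster_point k \<delta> t)) {..<n}"
proof -
  let ?x = "cluster_point k \<delta>"
  have "AE A in gaussian_matrix d n. t \<noteq> t' \<longrightarrow> lin_map d n A (?x t) \<noteq> lin_map d n A (?x t')"
    if t: "t < n" "t' < n" for t t'
  proof (cases "t = t'")
    case False
    then have "?x t \<noteq> ?x t'" using inj_cluster_point[OF \<delta>, of k n] t by (auto dest: inj_onD)
    then obtain q where q: "?x t q \<noteq> ?x t' q" by auto
    have "q < n"
    proof (rule ccontr)
      assume "\<not> q < n"
      then show False using q cluster_point_eq_0[OF t(1), of q] cluster_point_eq_0[OF t(2), of q] by simp
    qed
    with q have "AE A in gaussian_matrix d n. (\<Sum>j<n. A (0, j) * (?x t j - ?x t' j)) \<noteq> 0"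
      by (intro AE_row_nonzero[OF d, of q]) auto
    then show ?thesis
    proof eventually_elim
      case (elim A)
      then have "lin_map d n A (?x t) 0 \<noteq> lin_map d n A (?x t') 0"
        using d by (simp add: lin_map_def right_diff_distrib sum_subtractf)
      then show ?case by metis
    qed
  qed simp
  then have "AE A in gaussian_matrix d n. \<forall>t\<in>{..<n}. \<forall>t'\<in>{..<n}.
      t \<noteq> t' \<longrightarrow> lin_map d n A (?x t) \<noteq> lin_map d n A (?x t')"
    by (intro AE_finite_allI) auto
  then show ?thesis by eventually_elim (auto simp: inj_on_def)
qed

text \<open>Outside a null set and three bad events of probability at most 1/12 each, the pulled
  back cost is at least \<open>n / 2\<close>, while the minimum cost is at most
  \<open>4 * n / s\<close>. This leaves probability at least 3/4.\<close>

lemma prob_good_event: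
  fixes s n d :: nat
  assumes s: "s \<ge> 26624" and d: "d \<ge> 1"
    and n: "8192 * s\<^sup>2 * (3 * 2 ^ (200001 * 1024 * s + 1)) ^ d \<le> n"
  shows "measure (gaussian_matrix d n) {A \<in> space (gaussian_matrix d n).
    good_event d n (cluster_point (s\<^sup>2) (1 / real s) ` {..<n})
      (real s / 8 * mst_cost n (cluster_point (s\<^sup>2) (1 / real s) ` {..<n})) A} \<ge> 2 / 3"
    (is "measure ?M ?E \<ge> _")
proof -
  let ?x = "cluster_point (s\<^sup>2) (1 / real s)"
  define N where "N = (n - 1) div s\<^sup>2 + 1"
  have sn: "s\<^sup>2 \<le> n" "n > 0" "N \<le> n"
  proof -
    have "s\<^sup>2 * 1 \<le> s\<^sup>2 * (8192 * (3 * 2 ^ (200001 * 1024 * s + 1)) ^ d)"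
      by (intro mult_left_mono) auto
    also have "\<dots> = 8192 * s\<^sup>2 * (3 * 2 ^ (200001 * 1024 * s + 1)) ^ d"
      by (simp only: ac_simps)
    finally show *: "s\<^sup>2 \<le> n" using n by linarith
    have "s\<^sup>2 > 0" using s by simp
    with * show n_pos: "n > 0" by linarith
    have "(n - 1) div s\<^sup>2 \<le> n - 1" by (rule div_le_dividend)
    then show "N \<le> n" using n_pos unfolding N_def by linarith
  qed
  interpret prob_space ?M by (rule prob_space_gaussian_matrix[OF d])
  have \<delta>: "1 / real s > 0" using s by simp
  then have inj: "inj_on ?x {..<n}" by (rule inj_cluster_point)
  define B0 where "B0 = {A \<in> space ?M. (\<Sum>l<d. (A (l, 0))\<^sup>2) \<le> (1 / 32)\<^sup>2}"
  \<comment> \<open>Written as a sum over a single column so that \<open>prob_columns_large\<close>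
    applies.\<close>
  define B1 where "B1 = {A \<in> space ?M. (\<Sum>i\<in>{0}. \<Sum>l<d. (A (l, i))\<^sup>2) \<ge> 12 * real (card {0 :: nat})}"
  define B2 where "B2 = {A \<in> space ?M. (\<Sum>i<N. \<Sum>l<d. (A (l, i))\<^sup>2) \<ge> 12 * real (card {..<N})}"
  have pB: "prob B0 \<le> 1 / 12" "prob B1 \<le> 1 / 12" "prob B2 \<le> 1 / 12"
    unfolding B0_def B1_def B2_def using sn
    by (intro prob_column_small[OF d] prob_columns_large[OF d]; auto simp: N_def lessThan_empty_iff)+
  have E: "?E \<in> events" by (rule sets_good_event[OF inj]) simp
  have ent: "(\<lambda>A. \<Sum>l<d. (A (l, i))\<^sup>2) \<in> borel_measurable ?M" if "i < N" for i
    using that sn by (intro borel_measurable_sum borel_measurable_power measurable_entry) auto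
  have ents: "(\<lambda>A. \<Sum>i\<in>I. \<Sum>l<d. (A (l, i))\<^sup>2) \<in> borel_measurable ?M" if "I \<subseteq> {..<N}" for I
    using that by (intro borel_measurable_sum ent) auto
  have "0 < N" by (simp add: N_def)
  then have mB: "B0 \<in> events" "B1 \<in> events" "B2 \<in> events"
    unfolding B0_def B1_def B2_def
    using borel_measurable_le[OF ent[of 0] borel_measurable_const]
      borel_measurable_le[OF borel_measurable_const ents[of "{0}"]]
      borel_measurable_le[OF borel_measurable_const ents[of "{..<N}"]]
    by blast+
  have "AE A in ?M. A \<in> ?E \<union> (B0 \<union> (B1 \<union> B2))"
    using AE_inj_on_lin_map[OF d \<delta>, of n "s\<^sup>2"] AE_space
  proof eventually_elim
    case (elim A)
    show ?case
    proof (rule ccontr)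
      assume "A \<notin> ?E \<union> (B0 \<union> (B1 \<union> B2))"
      then have B: "A \<notin> B0" "A \<notin> B1" "A \<notin> B2" and nE: "A \<notin> ?E" by auto
      interpret projected_clusters s n d A
        by unfold_locales
           (use s d n B elim(2) in \<open>auto simp: B0_def B1_def B2_def N_def not_le\<close>)
      have M: "real s / 8 * mst_cost n (?x ` {..<n}) \<le> n / 2"
      proof -
        have "real s / 8 * mst_cost n (?x ` {..<n}) \<le> real s / 8 * (4 * n / s)"
          using mst_cost_bound[of s n] s sn by (intro mult_left_mono) auto
        then show ?thesis using s by simp
      qed
      have "real s / 8 * mst_cost n (?x ` {..<n}) \<le> wcost (\<lambda>u v. edist n (?x u) (?x v)) S"
        if "spanning_tree {..<n} S"
          "\<And>S'. spanning_tree {..<n} S' \<Longrightarrow>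
            wcost (\<lambda>u v. edist d (lin_map d n A (?x u)) (lin_map d n A (?x v))) S \<le>
            wcost (\<lambda>u v. edist d (lin_map d n A (?x u)) (lin_map d n A (?x v))) S'" for S
      proof -
        have "n / 2 \<le> wcost (\<lambda>u v. edist n (x u) (x v)) S"
          using that(1) by (rule pulled_back_cost_bound)
            (use that(2) in \<open>simp only: wG_def x_def k_def \<delta>_def\<close>)
        with M show ?thesis unfolding x_def k_def \<delta>_def by linarith
      qed
      then have "good_event d n (?x ` {..<n}) (real s / 8 * mst_cost n (?x ` {..<n})) A"
        unfolding good_event_iff[OF inj] using elim(1) s by auto
      then show False using nE elim(2) by simp
    qed
  qed
  then have "prob (?E \<union> (B0 \<union> (B1 \<union> B2))) = 1"
    by (rule prob_eq_1[THEN iffD2, rotated]) (intro sets.Un E mB)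
  moreover have "prob (?E \<union> (B0 \<union> (B1 \<union> B2))) \<le> prob ?E + prob (B0 \<union> (B1 \<union> B2))"
    by (intro measure_Un_le sets.Un E mB)
  moreover have "prob (B0 \<union> (B1 \<union> B2)) \<le> prob B0 + prob (B1 \<union> B2)"
    by (intro measure_Un_le sets.Un mB)
  moreover have "prob (B1 \<union> B2) \<le> prob B1 + prob B2"
    by (intro measure_Un_le mB)
  ultimately show ?thesis using pB by linarith
qed

section \<open>Growth of the parameters\<close>

text \<open>The first two conditions are the parameter conditions of
  \<open>projected_clusters\<close>; the third makes the doubling constant at least
  \<open>sqrt n\<close>.\<close>

definition admissible :: "(nat \<Rightarrow> nat) \<Rightarrow> nat \<Rightarrow> nat \<Rightarrow> bool" where
  "admissible d s n \<longleftrightarrow> 26624 \<le> s \<and>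
    8192 * s\<^sup>2 * (3 * 2 ^ (200001 * 1024 * s + 1)) ^ d n \<le> n \<and>
    sqrt (real n) \<le> real ((n - 1) div s\<^sup>2)"

text \<open>For fixed \<open>s\<close> the bound on the number of cells is \<open>C ^ d n\<close>
  with \<open>C\<close> constant, eventually at most \<open>sqrt n\<close> because
  \<open>d n = o(ln n)\<close>. The other factor \<open>8192 * s\<^sup>2\<close> is at most
  \<open>sqrt n\<close> for large \<open>n\<close>.\<close>

lemma eventually_admissible:
  fixes d :: "nat \<Rightarrow> nat"
  assumes d: "(\<lambda>n. real (d n)) \<in> o(\<lambda>n. ln (real n))" and s: "s \<ge> 26624"
  shows "\<forall>\<^sub>F n in sequentially. admissible d s n"
proof -
  define C :: nat where "C = 3 * 2 ^ (200001 * 1024 * s + 1)"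
  have "(1 :: nat) \<le> 2 ^ (200001 * 1024 * s + 1)" by (rule one_le_power) simp
  then have C: "C > 1" unfolding C_def by linarith
  define c where "c = ln (real C)"
  have c: "c > 0" using C by (simp add: c_def)
  have "\<forall>\<^sub>F n in sequentially. norm (real (d n)) \<le> 1 / (2 * c) * norm (ln (real n))"
    using landau_o.smallD[OF d, of "1 / (2 * c)"] c by simp
  moreover have "\<forall>\<^sub>F n in sequentially. n \<ge> (8192 * s\<^sup>2 + 1)\<^sup>2" by (rule eventually_ge_at_top)
  ultimately show ?thesis
  proof eventually_elim
    case (elim n)
    define r where "r = sqrt (real n)"
    have "real ((8192 * s\<^sup>2 + 1)\<^sup>2) \<le> real n" using elim(2) by (simp only: of_nat_le_iff)
    then have "(real (8192 * s\<^sup>2 + 1))\<^sup>2 \<le> real n" by (simp only: of_nat_power)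
    then have "real (8192 * s\<^sup>2 + 1) \<le> r" unfolding r_def by (rule real_le_rsqrt)
    then have r: "8192 * (real s)\<^sup>2 + 1 \<le> r" by simp
    have s2: "(real s)\<^sup>2 \<ge> 1" using s by (simp add: one_le_power)
    have r1: "r \<ge> 1" using r s2 by linarith
    have rr: "r * r = n" by (simp add: r_def)
    have n1: "real n \<ge> 1" using r1 mult_mono[of 1 r 1 r] rr by simp
    have "real (C ^ d n) = exp (d n * c)" using C by (simp add: c_def exp_of_nat_mult)
    also have "d n * c \<le> ln n / 2"
    proof -
      have "real (d n) \<le> 1 / (2 * c) * ln n" using elim(1) n1 by simp
      then have "real (d n) * c \<le> 1 / (2 * c) * ln n * c" using c by (intro mult_right_mono) auto
      then show ?thesis using c by simp
    qed
    also have "exp (ln n / 2) = r"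
      using n1 by (simp add: r_def ln_sqrt [symmetric])
    finally have Cd: "real (C ^ d n) \<le> r" by simp
    have "8192 * (real s)\<^sup>2 * real (C ^ d n) \<le> r * r"
      using r Cd r1 by (intro mult_mono) auto
    then have "real (8192 * s\<^sup>2 * C ^ d n) \<le> real n" by (simp add: rr)
    then have 1: "8192 * s\<^sup>2 * C ^ d n \<le> n" by (simp only: of_nat_le_iff)
    have "n - 1 < (n - 1) div s\<^sup>2 * s\<^sup>2 + s\<^sup>2"
    proof -
      have "(n - 1) mod s\<^sup>2 < s\<^sup>2" using s by (intro mod_less_divisor) simp
      then show ?thesis using div_mult_mod_eq[of "n - 1" "s\<^sup>2"] by linarith
    qed
    then have "real (n - 1) \<le> real ((n - 1) div s\<^sup>2 * s\<^sup>2 + s\<^sup>2)" by (simp only: of_nat_le_iff less_imp_le)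
    then have n_le: "real n - 1 \<le> (real ((n - 1) div s\<^sup>2) + 1) * (real s)\<^sup>2"
      using n1 by (simp add: of_nat_diff algebra_simps)
    \<comment> \<open>Otherwise the clusters would hold only about
      \<open>(sqrt n + 1) * s\<^sup>2\<close> points, far fewer than \<open>n\<close>, as
      \<open>s\<^sup>2\<close> is below \<open>sqrt n / 8192\<close>.\<close>
    have "r \<le> real ((n - 1) div s\<^sup>2)"
    proof (rule ccontr)
      assume "\<not> r \<le> real ((n - 1) div s\<^sup>2)"
      then have "(real ((n - 1) div s\<^sup>2) + 1) * (real s)\<^sup>2 \<le> (r + 1) * (real s)\<^sup>2"
        by (intro mult_right_mono) auto
      also have "\<dots> \<le> (r + 1) * (r / 8192)" using r r1 by (intro mult_left_mono) auto
      also have "\<dots> = r * r / 8192 + r / 8192" by (simp add: algebra_simps)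
      also have "\<dots> \<le> r * r / 8192 + r * r / 8192"
      proof -
        have "r \<le> r * r" using mult_right_mono[of 1 r r] r1 by simp
        then show ?thesis by linarith
      qed
      finally have "r * r - 1 \<le> r * r / 4096" using n_le rr by linarith
      moreover have "r * r \<ge> 8192 * 8192" using r s2 by (intro mult_mono) auto
      ultimately show False by linarith
    qed
    then show ?case using 1 s unfolding admissible_def C_def r_def by blast
  qed
qed

text \<open>Between \<open>sqrt n\<close> and \<open>n\<close> the logarithm varies by a factor of
  at most 2, and changing its base costs a constant.\<close>

lemma doubling_dim_bigtheta:
  assumes "\<forall>\<^sub>F n in sequentially. sqrt (real n) \<le> real (D n) \<and> D n \<le> n"
  shows "(\<lambda>n. log 2 (real (D n))) \<in> \<Theta>(\<lambda>n. ln (real n))"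
proof (rule bigthetaI'[of "1 / (2 * ln 2)" "1 / ln 2"])
  have "\<forall>\<^sub>F n in sequentially. n \<ge> (1 :: nat)" by (rule eventually_ge_at_top)
  with assms show "\<forall>\<^sub>F n in sequentially. 1 / (2 * ln 2) * norm (ln (real n)) \<le> norm (log 2 (real (D n))) \<and>
      norm (log 2 (real (D n))) \<le> 1 / ln 2 * norm (ln (real n))"
  proof eventually_elim
    case (elim n)
    have "sqrt (real n) \<ge> 1" using elim(2) by simp
    then have D: "real (D n) \<ge> 1" using elim(1) by linarith
    have "ln (real n) / 2 \<le> ln (real (D n))"
      using elim D by (subst ln_sqrt [symmetric]) auto
    moreover have "ln (real (D n)) \<le> ln (real n)" using elim D by simp
    ultimately show ?case
      using D elim(2) by (simp add: log_def field_simps)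
  qed
qed simp_all

theorem theorem6p3:
  fixes d :: "nat \<Rightarrow> nat"
  assumes "\<And>n. d n \<ge> 1"
    and "(\<lambda>n. real (d n)) \<in> o(\<lambda>n. ln (real n))"
  shows "\<exists>(m :: nat \<Rightarrow> nat) (X :: nat \<Rightarrow> (nat \<Rightarrow> real) set) (K :: nat \<Rightarrow> real).
    (\<forall>\<^sub>F n in sequentially.
       X n \<subseteq> topspace (Euclidean_space (m n)) \<and> finite (X n) \<and> card (X n) = n) \<and>
    (\<lambda>n. doubling_dim (m n) (X n)) \<in> \<Theta>(\<lambda>n. ln (real n)) \<and>
    filterlim K at_top sequentially \<and>
    (\<forall>\<^sub>F n in sequentially.
       \<P>(A in gaussian_matrix (d n) (m n).
          inj_on (lin_map (d n) (m n) A) (X n) \<and>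
          (\<forall>T. is_mst (d n) (lin_map (d n) (m n) A ` X n) T \<longrightarrow>
             tree_cost (m n) (pull_back (lin_map (d n) (m n) A) (X n) T)
               \<ge> K n * mst_cost (m n) (X n))) \<ge> 2 / 3)"
proof -
  \<comment> \<open>Diagonal choice: \<open>s n\<close> is the largest admissible parameter up to
    \<open>n\<close>. The bound \<open>s \<le> n\<close> makes the set finite, and the default 0
    makes it nonempty.\<close>
  define F where "F n = {s. s \<le> n \<and> (s = 0 \<or> admissible d s n)}" for n
  define s where "s n = Max (F n)" for n
  define X where "X n = cluster_point ((s n)\<^sup>2) (1 / real (s n)) ` {..<n}" for n
  have F: "finite (F n)" "0 \<in> F n" for n by (auto simp: F_def)
  \<comment> \<open>Each fixed \<open>a\<close> from the threshold on is eventually admissible,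
    hence eventually a lower bound for \<open>s n\<close>.\<close>
  have s_ge: "\<forall>\<^sub>F n in sequentially. a \<le> s n" if "a \<ge> 26624" for a
    using eventually_admissible[OF assms(2) that] eventually_ge_at_top[of a]
  proof eventually_elim
    case (elim n)
    then have "a \<in> F n" by (simp add: F_def)
    then show ?case unfolding s_def using F(1) by (intro Max_ge)
  qed
  have s_top: "filterlim s at_top sequentially"
    unfolding filterlim_at_top
  proof
    fix Z :: nat
    from s_ge[of "max Z 26624"] show "\<forall>\<^sub>F n in sequentially. Z \<le> s n"
      by (auto elim: eventually_mono)
  qed
  \<comment> \<open>Once \<open>s n\<close> reaches the threshold it is not the default 0, so it is
    admissible.\<close>
  have adm: "\<forall>\<^sub>F n in sequentially. admissible d (s n) n"
    using s_ge[OF order_refl]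
  proof eventually_elim
    case (elim n)
    have "s n \<in> F n" unfolding s_def using F by (intro Max_in) auto
    then show ?case using elim by (simp add: F_def)
  qed
  have "\<forall>\<^sub>F n in sequentially. X n \<subseteq> topspace (Euclidean_space n) \<and> finite (X n) \<and> card (X n) = n"
    using adm
  proof eventually_elim
    case (elim n)
    then have "inj_on (cluster_point ((s n)\<^sup>2) (1 / real (s n))) {..<n}"
      by (intro inj_cluster_point) (auto simp: admissible_def)
    then show ?case
      by (auto simp: X_def card_image topspace_Euclidean_space intro: cluster_point_eq_0)
  qed
  moreover have "(\<lambda>n. doubling_dim n (X n)) \<in> \<Theta>(\<lambda>n. ln (real n))"
    unfolding doubling_dim_def
  proof (rule doubling_dim_bigtheta)
    show "\<forall>\<^sub>F n in sequentially. sqrt (real n) \<le> real (doubling_const n (X n)) \<and> doubling_const n (X n) \<le> n"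
      using adm eventually_gt_at_top[of 0]
    proof eventually_elim
      case (elim n)
      then have s: "(s n)\<^sup>2 > 0" "1 / real (s n) > 0" by (auto simp: admissible_def)
      have "real ((n - 1) div (s n)\<^sup>2) \<le> real (doubling_const n (X n))"
        unfolding X_def of_nat_le_iff by (rule doubling_const_cluster_points(2)[OF elim(2) s])
      then show ?case
        using elim(1) doubling_const_cluster_points(1)[OF elim(2) s] by (simp add: admissible_def X_def)
    qed
  qed
  moreover have "filterlim (\<lambda>n. real (s n) / 8) at_top sequentially"
    using filterlim_compose[OF filterlim_real_sequentially s_top]
    by (intro filterlim_at_top_mult_tendsto_pos[where c = "1 / 8" and f = "\<lambda>_. 1 / 8", simplified]) auto
  moreover have "\<forall>\<^sub>F n in sequentially.
      \<P>(A in gaussian_matrix (d n) n. good_event (d n) n (X n) (real (s n) / 8 * mst_cost n (X n)) A) \<ge> 2 / 3"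
    using adm
  proof eventually_elim
    case (elim n)
    then show ?case
      unfolding X_def admissible_def by (intro prob_good_event[OF _ assms(1)]) auto
  qed
  ultimately show ?thesis
    unfolding good_event_def
    \<comment> \<open>The ambient dimension is \<open>n\<close>, and \<open>K n = s n / 8\<close> is
      the quotient of the lower bound \<open>n / 2\<close> by the upper bound
      \<open>4 * n / s n\<close>.\<close>
    by (intro exI[of _ "\<lambda>n. n"] exI[of _ X] exI[of _ "\<lambda>n. real (s n) / 8"] conjI) auto
qed

end
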